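(* Let $n\ge 1$ and $1<p<\infty$. There is a constant $B_{n,p}>0$ depending only on $n$ and $p$ such that the following holds. Let $w$ be a weight in $\mathbb{R}^n$ such that $0<[w]_{C_p}<\infty$. Then $w\in C_p$ and, for $\delta=\dfrac{1}{B_{n,p}\max([w]_{C_p},1)}$ and every cube $Q\subset\mathbb{R}^n$, $$\left(\frac{1}{|Q|}\int_Q w^{1+\delta}\,dx\right)^{\frac{1}{1+\delta}}\le \frac{4}{|Q|}\int_{\mathbb{R}^n}(M\chi_Q)^p\,w\,dx.$$
   Context: A weight is a non-negative locally integrable function on $\mathbb{R}^n$. Cubes have sides parallel to the coordinate axes. $\chi_E$ is the characteristic function of $E$, $w(E)=\int_E w\,dx$, and $M$ is the Hardy--Littlewood maximal operator $Mf(x)=\sup_Q \frac{\chi_Q(x)}{|Q|}\int_Q|f|$, the supremum being over all cubes $Q$. Class $C_p$ ($1<p<\infty$): $w\in C_p$ if there exist $C,\varepsilon>0$ such that for every cube $Q$ and every measurable $E\subset Q$, $w(E)\le C\left(\frac{|E|}{|Q|}\right)^{\varepsilon}\int_{\mathbb{R}^n}(M\chi_Q)^p w\,dx$. $C_p$ constant: for a weight $w$ that is not a.e. zero, $[w]_{C_p}:=\sup_Q \frac{1}{\int_{\mathbb{R}^n}(M\chi_Q)^p w}\int_Q M(\chi_Q w)$, the supremum over all cubes, with the convention that the quotient is $0$ when the denominator is $+\infty$. (The denominator $\int(M\chi_Q)^pw$ is either finite for all cubes or infinite for all cubes.) *)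

theory Defs
  imports "HOL-Analysis.Analysis"
begin

text \<open>Cubes are closed; open or half-open ones give the same integrals and, on locally
  integrable functions, the same maximal function.\<close>

definition cubes :: "(real ^ 'n) set set" where
  "cubes = {Q. \<exists>a l. 0 < l \<and> Q = cbox a (\<chi> i. a $ i + l)}"

definition weight :: "(real ^ 'n \<Rightarrow> real) \<Rightarrow> bool" where
  "weight w \<longleftrightarrow> (\<forall>x. 0 \<le> w x) \<and> w \<in> borel_measurable lebesgue \<and>
     (\<forall>K. compact K \<longrightarrow> set_integrable lebesgue K w)"

definition wmeasure :: "(real ^ 'n \<Rightarrow> real) \<Rightarrow> (real ^ 'n) set \<Rightarrow> ennreal" where
  "wmeasure w E = (\<integral>\<^sup>+x\<in>E. ennreal (w x) \<partial>lebesgue)"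

definition HL_maximal :: "(real ^ 'n \<Rightarrow> real) \<Rightarrow> real ^ 'n \<Rightarrow> ennreal" where
  "HL_maximal f x =
     (SUP Q\<in>cubes. indicator Q x / emeasure lebesgue Q * (\<integral>\<^sup>+y\<in>Q. ennreal \<bar>f y\<bar> \<partial>lebesgue))"

text \<open>Power with a positive real exponent on the extended half-line, so that
  \<open>\<infinity>\<close> is sent to \<open>\<infinity>\<close>; the library's \<open>powr\<close> does not cover \<^typ>\<open>ennreal\<close>.
  It is only meant for exponents \<open>a > 0\<close>.\<close>

definition epowr :: "ennreal \<Rightarrow> real \<Rightarrow> ennreal" where
  "epowr x a = (if x = \<infinity> then \<infinity> else ennreal (enn2real x powr a))"

definition Cp_tail :: "real \<Rightarrow> (real ^ 'n \<Rightarrow> real) \<Rightarrow> (real ^ 'n) set \<Rightarrow> ennreal" where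
  "Cp_tail p w Q =
     (\<integral>\<^sup>+x. epowr (HL_maximal (indicator Q) x) p * ennreal (w x) \<partial>lebesgue)"

definition Cp_class :: "real \<Rightarrow> (real ^ 'n \<Rightarrow> real) set" where
  "Cp_class p = {w. weight w \<and>
     (\<exists>C \<epsilon> :: real. 0 < C \<and> 0 < \<epsilon> \<and>
       (\<forall>Q\<in>cubes. \<forall>E\<in>sets lebesgue. E \<subseteq> Q \<longrightarrow>
         wmeasure w E
           \<le> ennreal (C * (measure lebesgue E / measure lebesgue Q) powr \<epsilon>) * Cp_tail p w Q))}"

text \<open>For \<open>w\<close> a.e. zero, where the constant is not considered, every quotient is
  \<open>0 / 0 = 0\<close> in \<^typ>\<open>ennreal\<close> and the value below is \<open>0\<close>.\<close>

definition Cp_const :: "real \<Rightarrow> (real ^ 'n \<Rightarrow> real) \<Rightarrow> ennreal" where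
  "Cp_const p w =
     (SUP Q\<in>cubes. if Cp_tail p w Q = \<infinity> then 0
        else (\<integral>\<^sup>+x\<in>Q. HL_maximal (\<lambda>y. indicator Q y * w y) x \<partial>lebesgue) / Cp_tail p w Q)"

end

theory Submission
  imports Defs
begin

text \<open>Write \<open>a(Q)\<close> for the integral of \<open>(M\<chi>\<^sub>Q)\<^sup>p w\<close> and \<open>A(Q) = a(Q) / |Q|\<close>. The argument is that of
  Hytonen and Perez for \<open>A\<^sub>\<infinity>\<close> weights, with the averages of \<open>w\<close> replaced by \<open>A\<close> as the stopping
  functional on the dyadic descendants of a cube \<open>Q\<close>. Since \<open>a\<close> is monotone, \<open>A\<close> grows by at most \<open>2\<^sup>n\<close>
  from a cube to its child. Moreover \<open>A(R) \<le> C (M(\<chi>\<^bsub>3Q\<^esub> w)(x) + A(Q))\<close> for \<open>x \<in> R \<subseteq> Q\<close>, so that the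
  dyadic maximal function \<open>F\<close> of \<open>A\<close> on \<open>Q\<close> satisfies \<open>\<integral>\<^sub>Q F \<le> K a(Q)\<close>, where \<open>K\<close> is a multiple of
  \<open>max [w] 1\<close>. Summing over the cubes where the running maximum jumps (instead of integrating over level
  sets) yields first \<open>\<integral>\<^sub>Q F\<^bsup>1+e\<^esup> \<le> 2 K A(Q)\<^bsup>1+e\<^esup> |Q|\<close> and then \<open>\<integral>\<^sub>Q F\<^sup>e w \<le> 2 A(Q)\<^bsup>1+e\<^esup> |Q|\<close> for
  \<open>e \<approx> 1 / (2\<^sup>n K)\<close>; with finitely many generations, the terms to be absorbed are finite. Finally
  \<open>w \<le> C F\<close> almost everywhere, and \<open>C\<^sup>e \<le> 2\<close>.\<close>

subsection \<open>Stopping on trees\<close>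

text \<open>By homogeneity only t = \<open>A / f\<close> in (1, \<open>D\<close>] matters. The bound
  exp(-u) \<ge> 1 - u at u = e ln t gives t^e - 1 \<le> e (t - 1) t^e \<le> e (t^(1+e) - 1), and the
  remaining factor t is at most \<open>D\<close>. The gain is the small factor \<open>e\<close> on
  the right, which later permits absorption.\<close>

lemma powr_step_le:
  fixes f A D e :: real
  assumes "0 < f" "f < A" "A \<le> D * f" "0 < e"
  shows "(A powr e - f powr e) * A \<le> D * e * (A powr (1 + e) - f powr (1 + e))"
proof -
  define t where "t = A / f"
  have t: "1 < t" "t \<le> D" and A: "A = t * f" "0 < A"
    using assms by (auto simp: t_def field_simps)
  have te: "1 \<le> t powr e"
    using t assms by (simp add: ge_one_powr_ge_zero)
  have "1 - e * ln t \<le> exp (- (e * ln t))"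
    using exp_ge_add_one_self[of "- (e * ln t)"] by simp
  then have "1 - 1 / t powr e \<le> e * ln t"
    using t by (simp add: powr_def exp_minus inverse_eq_divide)
  then have "(1 - 1 / t powr e) * t powr e \<le> e * ln t * t powr e"
    using te by (intro mult_right_mono) auto
  then have "t powr e - 1 \<le> e * ln t * t powr e"
    using te t by (simp add: left_diff_distrib)
  also have "\<dots> \<le> e * (t - 1) * t powr e"
    using assms t ln_le_minus_one[of t] by (intro mult_right_mono mult_left_mono) auto
  also have "\<dots> \<le> e * (t powr (1 + e) - 1)"
    using te t assms by (simp add: powr_add algebra_simps)
  finally have 1: "t powr e - 1 \<le> e * (t powr (1 + e) - 1)" .
  have "t * (t powr e - 1) \<le> D * (t powr e - 1)"
    using t te by (intro mult_right_mono) auto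
  also have "\<dots> \<le> D * (e * (t powr (1 + e) - 1))"
    using 1 t by (intro mult_left_mono) auto
  finally have "t * (t powr e - 1) * f powr (1 + e) \<le> D * (e * (t powr (1 + e) - 1)) * f powr (1 + e)"
    by (intro mult_right_mono) auto
  moreover have "A powr e = t powr e * f powr e" "A powr (1 + e) = t powr (1 + e) * f powr (1 + e)"
    using A t assms by (auto simp: powr_mult)
  moreover have "f powr (1 + e) = f * f powr e"
    using assms by (simp add: powr_add)
  ultimately show ?thesis
    unfolding A(1) by (simp add: algebra_simps)
qed

text \<open>The dyadic subcubes of a cube, reduced to what the stopping argument uses. Volumes add
  up over the children; \<open>A * vol\<close> is not assumed additive and is controlled only
  through the growth factor \<open>D\<close> from a node to its child.\<close>

locale stopping_tree =
  fixes node :: "'r \<Rightarrow> bool" and child :: "'r \<Rightarrow> 's::finite \<Rightarrow> 'r"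
    and vol A :: "'r \<Rightarrow> real" and D :: real
  assumes node_child: "node R \<Longrightarrow> node (child R s)"
    and vol_nonneg: "node R \<Longrightarrow> 0 \<le> vol R"
    and vol_children: "node R \<Longrightarrow> (\<Sum>s\<in>UNIV. vol (child R s)) = vol R"
    and A_nonneg: "node R \<Longrightarrow> 0 \<le> A R"
    and A_child: "node R \<Longrightarrow> A (child R s) \<le> D * A R"
begin

text \<open>The integral over \<open>R\<close> of a function that is constant on the descendants of generation
  \<open>k\<close>: the second argument of \<open>\<Phi>\<close> is the running maximum of \<open>A\<close>, started at \<open>f\<close>.\<close>

primrec tree_sum :: "nat \<Rightarrow> ('r \<Rightarrow> real \<Rightarrow> real) \<Rightarrow> 'r \<Rightarrow> real \<Rightarrow> real" where
  "tree_sum 0 \<Phi> R f = \<Phi> R f"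
| "tree_sum (Suc k) \<Phi> R f =
     (\<Sum>s\<in>UNIV. tree_sum k \<Phi> (child R s) (max f (A (child R s))))"

lemma tree_sum_cong:
  assumes "\<And>R f. node R \<Longrightarrow> 0 \<le> f \<Longrightarrow> \<Phi> R f = \<Psi> R f" and "node R" "0 \<le> f"
  shows "tree_sum k \<Phi> R f = tree_sum k \<Psi> R f"
  using assms(2,3)
proof (induction k arbitrary: R f)
  case 0
  then show ?case by (simp add: assms(1))
next
  case (Suc k)
  then show ?case
    by (auto intro!: sum.cong Suc.IH node_child)
qed

lemma tree_sum_nonneg:
  assumes "\<And>R f. node R \<Longrightarrow> 0 \<le> f \<Longrightarrow> 0 \<le> \<Phi> R f" and "node R" "0 \<le> f"
  shows "0 \<le> tree_sum k \<Phi> R f"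
  using assms(2,3)
proof (induction k arbitrary: R f)
  case (Suc k)
  then show ?case by (auto intro!: sum_nonneg Suc.IH node_child)
qed (simp add: assms(1))

lemma tree_sum_additive:
  assumes "\<And>R. node R \<Longrightarrow> (\<Sum>s\<in>UNIV. g (child R s)) = g R" and "node R"
  shows "tree_sum k (\<lambda>R _. g R) R f = g R"
  using assms(2)
  by (induction k arbitrary: R f) (simp_all add: assms(1) node_child)

text \<open>Only the record cubes, where the running maximum jumps, contribute to the difference of the
  two sides, and there \<open>powr_step_le\<close> applies because a jump is at most by the factor \<open>D\<close>.\<close>

lemma tree_sum_powr_le:
  assumes e: "0 < e" and K: "0 \<le> K"
    and mass: "\<And>k R. node R \<Longrightarrow> tree_sum k \<Gamma> R (A R) \<le> K * (A R * vol R)"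
    and R: "node R" and f: "A R \<le> f"
  shows "tree_sum k (\<lambda>R f. f powr e * \<Gamma> R f) R f + D * K * e * (f powr (1 + e) * vol R)
    \<le> f powr e * tree_sum k \<Gamma> R f
      + D * K * e * tree_sum k (\<lambda>R f. f powr (1 + e) * vol R) R f"
  using R f
proof (induction k arbitrary: R f)
  case 0
  then show ?case by simp
next
  case (Suc k)
  note R = \<open>node R\<close>
  define c where "c = D * K * e"
  define F where "F s = max f (A (child R s))" for s
  have f0: "0 \<le> f"
    using A_nonneg[OF R] Suc.prems by linarith
  have step: "F s powr e * tree_sum k \<Gamma> (child R s) (F s) + c * (f powr (1 + e) * vol (child R s))
     \<le> f powr e * tree_sum k \<Gamma> (child R s) (F s) + c * (F s powr (1 + e) * vol (child R s))" for s
  proof (cases "A (child R s) \<le> f")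
    case True
    then show ?thesis by (simp add: F_def max_def)
  next
    case False
    let ?R = "child R s"
    have F: "F s = A ?R" using False by (simp add: F_def)
    have R': "node ?R" by (rule node_child[OF R])
    have AD: "A ?R \<le> D * A R" by (rule A_child[OF R])
    have Apos: "0 < D * A R" "0 < A ?R" using AD False f0 by linarith+
    then have AR: "0 < A R" "0 < D"
      using A_nonneg[OF R] by (auto simp: zero_less_mult_iff)
    have "A ?R \<le> D * f"
      using AD mult_left_mono[OF Suc.prems(2), of D] AR by linarith
    then have st: "(A ?R powr e - f powr e) * A ?R \<le> D * e * (A ?R powr (1 + e) - f powr (1 + e))"
      using False AR Suc.prems e by (intro powr_step_le) auto
    \<comment> \<open>At a record cube the running maximum is the cube's own value
      \<open>A ?R\<close>, which is exactly the starting value for which \<open>mass\<close> is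
      available.\<close>
    have "(A ?R powr e - f powr e) * tree_sum k \<Gamma> ?R (A ?R)
        \<le> (A ?R powr e - f powr e) * (K * (A ?R * vol ?R))"
      using False f0 e by (intro mult_left_mono mass R') (auto intro!: powr_mono2)
    also have "\<dots> = K * vol ?R * ((A ?R powr e - f powr e) * A ?R)" by simp
    also have "\<dots> \<le> K * vol ?R * (D * e * (A ?R powr (1 + e) - f powr (1 + e)))"
      using K vol_nonneg[OF R'] by (intro mult_left_mono st) auto
    finally show ?thesis
      unfolding F c_def by (simp add: algebra_simps)
  qed
  have IH: "tree_sum k (\<lambda>R f. f powr e * \<Gamma> R f) (child R s) (F s) + c * (F s powr (1 + e) * vol (child R s))
     \<le> F s powr e * tree_sum k \<Gamma> (child R s) (F s)
       + c * tree_sum k (\<lambda>R f. f powr (1 + e) * vol R) (child R s) (F s)" for s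
    unfolding c_def by (rule Suc.IH[OF node_child[OF R]]) (simp add: F_def)
  have "tree_sum k (\<lambda>R f. f powr e * \<Gamma> R f) (child R s) (F s) + c * (f powr (1 + e) * vol (child R s))
     \<le> f powr e * tree_sum k \<Gamma> (child R s) (F s)
       + c * tree_sum k (\<lambda>R f. f powr (1 + e) * vol R) (child R s) (F s)" for s
    using IH[of s] step[of s] by linarith
  then have "(\<Sum>s\<in>UNIV. tree_sum k (\<lambda>R f. f powr e * \<Gamma> R f) (child R s) (F s)
        + c * (f powr (1 + e) * vol (child R s)))
     \<le> (\<Sum>s\<in>UNIV. f powr e * tree_sum k \<Gamma> (child R s) (F s)
       + c * tree_sum k (\<lambda>R f. f powr (1 + e) * vol R) (child R s) (F s))"
    by (rule sum_mono)
  then show ?case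
    unfolding sum.distrib sum_distrib_left[symmetric] vol_children[OF R]
      c_def[symmetric] F_def[symmetric] tree_sum.simps .
qed

text \<open>\<open>tree_sum_powr_le\<close> is used twice. First \<open>\<Gamma>\<close> is the
  running maximum times volume: then the same sum \<open>T\<close> stands on both sides, and since
  \<open>D * K * e\<close> is at most 1/2 it can be absorbed, leaving
  \<open>T \<le> 2 * K * V\<close>. Then \<open>\<Gamma>\<close> is \<open>g\<close>, where the
  bound on \<open>T\<close> enters with the factor \<open>D * e\<close>; this compensates
  \<open>K\<close>, so that the final constant 2 does not depend on \<open>K\<close>.\<close>

theorem tree_sum_reverse_Holder:
  assumes e: "0 < e" "2 * (D * K * e) \<le> 1" and K: "0 < K" and D: "0 \<le> D"
    and mass: "\<And>k R. node R \<Longrightarrow> tree_sum k (\<lambda>R f. f * vol R) R (A R) \<le> K * (A R * vol R)"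
    and g_add: "\<And>R. node R \<Longrightarrow> (\<Sum>s\<in>UNIV. g (child R s)) = g R"
    and g_le: "\<And>R. node R \<Longrightarrow> g R \<le> A R * vol R"
    and R: "node R"
  shows "tree_sum k (\<lambda>R f. f powr e * g R) R (A R) \<le> 2 * (A R powr (1 + e) * vol R)"
proof -
  define T where "T = tree_sum k (\<lambda>R f. f powr (1 + e) * vol R) R (A R)"
  define V where "V = A R powr (1 + e) * vol R"
  have A0: "0 \<le> A R" and V0: "0 \<le> V"
    using A_nonneg[OF R] vol_nonneg[OF R] by (auto simp: V_def)
  have AV: "A R powr e * (A R * vol R) = V"
    using A0 by (cases "A R = 0") (auto simp: V_def powr_add)
  have "tree_sum k (\<lambda>R f. f powr e * (f * vol R)) R (A R) = T"
    unfolding T_def using e by (intro tree_sum_cong R A0) (simp add: powr_add)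
  then have "T + D * K * e * V
      \<le> A R powr e * tree_sum k (\<lambda>R f. f * vol R) R (A R) + D * K * e * T"
    using tree_sum_powr_le[where \<Gamma>="\<lambda>R f. f * vol R" and K=K and k=k, OF e(1) _ mass R order_refl] K
    by (simp add: T_def V_def)
  also have "\<dots> \<le> A R powr e * (K * (A R * vol R)) + D * K * e * T"
    by (intro add_right_mono mult_left_mono mass R) auto
  also have "\<dots> = K * V + D * K * e * T" using AV by (simp add: algebra_simps)
  finally have "T + D * K * e * V \<le> K * V + D * K * e * T" .
  moreover have "0 \<le> D * K * e * V"
    using D K e V0 by simp
  ultimately have "T * (1 - D * K * e) \<le> K * V"
    by (simp add: algebra_simps)
  \<comment> \<open>Absorption: half of \<open>T\<close> survives on the left. If \<open>T\<close>
    is negative, the bound claimed for it is trivial.\<close>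
  moreover have "T * (1 / 2) \<le> T * (1 - D * K * e)" if "0 \<le> T"
    using that e by (intro mult_left_mono) auto
  moreover have "0 \<le> K * V"
    using K V0 by simp
  ultimately have T: "T \<le> 2 * K * V"
    by (cases "0 \<le> T") linarith+
  \<comment> \<open>Additivity makes the tree sum of \<open>g\<close> equal to \<open>g R\<close> at
    every depth, so the mass hypothesis holds for \<open>g\<close> with constant 1 in place of
    \<open>K\<close>.\<close>
  have "tree_sum k (\<lambda>R f. f powr e * g R) R (A R) + D * 1 * e * V
      \<le> A R powr e * tree_sum k (\<lambda>R f. g R) R (A R) + D * 1 * e * T"
    unfolding T_def V_def
    by (rule tree_sum_powr_le[where \<Gamma>="\<lambda>R f. g R"])
      (use e R g_le g_add in \<open>simp_all add: tree_sum_additive\<close>)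
  also have "\<dots> = A R powr e * g R + D * e * T"
    by (simp add: tree_sum_additive[OF g_add R])
  also have "\<dots> \<le> A R powr e * (A R * vol R) + D * e * (2 * K * V)"
    using D e by (intro add_mono mult_left_mono g_le R T) auto
  also have "\<dots> = V + 2 * (D * K * e) * V" using AV by (simp add: algebra_simps)
  also have "\<dots> \<le> V + 1 * V"
    using e V0 by (intro add_left_mono mult_right_mono) auto
  finally have "tree_sum k (\<lambda>R f. f powr e * g R) R (A R) + D * 1 * e * V \<le> V + 1 * V" .
  moreover have "0 \<le> D * 1 * e * V"
    using D e V0 by simp
  ultimately show ?thesis
    unfolding V_def by linarith
qed

end

subsection \<open>Cubes and the maximal function\<close>

definition cube :: "real ^ 'n \<Rightarrow> real \<Rightarrow> (real ^ 'n) set" where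
  "cube a l = cbox a (\<chi> i. a $ i + l)"

lemma mem_cube: "x \<in> cube a l \<longleftrightarrow> (\<forall>i. a $ i \<le> x $ i \<and> x $ i \<le> a $ i + l)"
  by (simp add: cube_def mem_box_cart)

lemma mem_cube_minus_vec:
  "x \<in> cube (a - vec r) l \<longleftrightarrow> (\<forall>i. a $ i - r \<le> x $ i \<and> x $ i \<le> a $ i - r + l)"
  by (simp add: mem_cube)

lemma cube_in_cubes: "0 < l \<Longrightarrow> cube a l \<in> cubes"
  by (auto simp: cubes_def cube_def)

lemma cubesE:
  assumes "Q \<in> cubes"
  obtains a l where "0 < l" "Q = cube a l"
  using assms by (auto simp: cubes_def cube_def)

lemma sets_cube [measurable, simp]: "cube a l \<in> sets lebesgue" "cube a l \<in> sets borel"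
  by (simp_all add: cube_def)

lemma emeasure_cube:
  fixes a :: "real ^ 'n"
  assumes "0 \<le> l"
  shows "emeasure lborel (cube a l) = ennreal (l ^ CARD('n))"
    and "emeasure lebesgue (cube a l) = ennreal (l ^ CARD('n))"
proof -
  have "emeasure lborel (cube a l) = ennreal (measure lborel (cube a l))"
    unfolding cube_def by (intro emeasure_eq_ennreal_measure) (simp add: emeasure_lborel_cbox_eq)
  also have "measure lborel (cube a l) = l ^ CARD('n)"
    unfolding cube_def using assms
    by (subst content_cbox_cart) (auto simp: interval_ne_empty_cart)
  finally show *: "emeasure lborel (cube a l) = ennreal (l ^ CARD('n))" .
  then show "emeasure lebesgue (cube a l) = ennreal (l ^ CARD('n))" by simp
qed

text \<open>The supremum tested with one cube, in product form so that later estimates avoid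
  division of extended reals.\<close>

lemma HL_maximal_ge:
  fixes x :: "real ^ 'n"
  assumes "0 < s" "x \<in> cube b s"
  shows "(\<integral>\<^sup>+y\<in>cube b s. ennreal \<bar>f y\<bar> \<partial>lebesgue) \<le> ennreal (s ^ CARD('n)) * HL_maximal f x"
    (is "?I \<le> ?v * _")
proof -
  have v: "?v \<noteq> 0" "?v \<noteq> \<infinity>" using assms by auto
  have "?I / ?v \<le> HL_maximal f x"
    unfolding HL_maximal_def
    by (rule SUP_upper2[OF cube_in_cubes[OF assms(1), of b]])
      (use assms in \<open>simp add: emeasure_cube ennreal_times_divide mult.commute divide_ennreal_def\<close>)
  then have "?v * (?I / ?v) \<le> ?v * HL_maximal f x"
    by (rule mult_left_mono) simp
  moreover have "?v * (?I / ?v) = ?I"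
    using v ennreal_mult_divide_eq[of ?v ?I] by (simp add: ennreal_times_divide mult.commute)
  ultimately show ?thesis by simp
qed

lemma HL_maximal_le:
  fixes x :: "real ^ 'n"
  assumes "\<And>b s. 0 < s \<Longrightarrow> x \<in> cube b s \<Longrightarrow>
    (\<integral>\<^sup>+y\<in>cube b s. ennreal \<bar>f y\<bar> \<partial>lebesgue) \<le> ennreal (s ^ CARD('n)) * C"
  shows "HL_maximal f x \<le> C"
  unfolding HL_maximal_def
proof (rule SUP_least)
  fix Q :: "(real ^ 'n) set" assume "Q \<in> cubes"
  then obtain b s where Q: "0 < s" "Q = cube b s" by (rule cubesE)
  show "indicator Q x / emeasure lebesgue Q * (\<integral>\<^sup>+y\<in>Q. ennreal \<bar>f y\<bar> \<partial>lebesgue) \<le> C"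
  proof (cases "x \<in> Q")
    case True
    then have "(\<integral>\<^sup>+y\<in>Q. ennreal \<bar>f y\<bar> \<partial>lebesgue) / ennreal (s ^ CARD('n)) \<le> C"
      using assms[of s b] Q by (intro divide_le_posI_ennreal) (auto simp: mult.commute)
    with True Q show ?thesis
      by (simp add: emeasure_cube divide_ennreal_def mult.commute)
  qed (simp add: divide_ennreal_def)
qed

lemma HL_maximal_mono:
  assumes "\<And>y. \<bar>f y\<bar> \<le> \<bar>g y\<bar>"
  shows "HL_maximal f x \<le> HL_maximal g x"
  unfolding HL_maximal_def
  by (intro SUP_mono' mult_left_mono nn_integral_mono mult_right_mono ennreal_leI assms) auto

text \<open>The cubes are closed, so the point may lie on the boundary of the cube whose average
  exceeds \<open>t\<close>. Enlarging this cube slightly on all sides keeps the average above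
  \<open>t\<close>, since the integral does not decrease and the volume depends continuously on the
  enlargement; the interior of the enlarged cube is then a neighbourhood of the point. Measurability
  follows from this lower semicontinuity.\<close>

lemma open_HL_maximal_greater: "open {x. t < HL_maximal f x}" for f :: "real ^ 'n \<Rightarrow> real"
proof (rule Topological_Spaces.openI)
  fix x :: "real ^ 'n" assume "x \<in> {x. t < HL_maximal f x}"
  then obtain Q where Q: "Q \<in> cubes"
    and t: "t < indicator Q x / emeasure lebesgue Q * (\<integral>\<^sup>+y\<in>Q. ennreal \<bar>f y\<bar> \<partial>lebesgue)"
    by (auto simp: HL_maximal_def less_SUP_iff)
  from Q obtain a l where l: "0 < l" and Qa: "Q = cube a l" by (rule cubesE)
  define I where "I = (\<integral>\<^sup>+y\<in>cube a l. ennreal \<bar>f y\<bar> \<partial>lebesgue)"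
  have x: "x \<in> cube a l"
    using t Qa by (cases "x \<in> cube a l") (auto simp: divide_ennreal_def)
  have tI: "t < I / ennreal (l ^ CARD('n))"
    using t x l by (simp add: Qa I_def emeasure_cube divide_ennreal_def mult.commute)
  have "((\<lambda>r. (l + 2 * r) ^ CARD('n)) \<longlongrightarrow> (l + 2 * 0) ^ CARD('n)) (at_right 0)"
    by (intro tendsto_intros)
  then have lim: "((\<lambda>r. ennreal ((l + 2 * r) ^ CARD('n))) \<longlongrightarrow> ennreal (l ^ CARD('n))) (at_right 0)"
    by (intro tendsto_ennrealI) simp
  have "((\<lambda>r. I / ennreal ((l + 2 * r) ^ CARD('n))) \<longlongrightarrow> I / ennreal (l ^ CARD('n))) (at_right 0)"
  proof (cases "I = \<infinity>")
    case True
    have "eventually (\<lambda>r. I / ennreal (l ^ CARD('n)) = I / ennreal ((l + 2 * r) ^ CARD('n))) (at_right 0)"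
      using l by (auto simp: eventually_at_right_field True ennreal_top_divide intro!: exI[of _ 1])
    then show ?thesis by (rule tendsto_eventually[OF eventually_mono]) simp
  next
    case False
    have "((\<lambda>r. inverse (ennreal ((l + 2 * r) ^ CARD('n)))) \<longlongrightarrow> inverse (ennreal (l ^ CARD('n))))
        (at_right 0)"
      by (rule continuous_on_tendsto_compose[OF continuous_on_inverse_ennreal[OF continuous_on_id]
            lim, of UNIV]) auto
    with False show ?thesis
      unfolding divide_ennreal_def using l
      by (intro tendsto_mult_ennreal tendsto_const) auto
  qed
  then have "eventually (\<lambda>r. t < I / ennreal ((l + 2 * r) ^ CARD('n))) (at_right 0)"
    using tI by (rule order_tendstoD)
  then have "eventually (\<lambda>r. 0 < r \<and> t < I / ennreal ((l + 2 * r) ^ CARD('n))) (at_right 0)"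
    using eventually_at_right_less[of 0] by eventually_elim simp
  then obtain r where r: "0 < r" "t < I / ennreal ((l + 2 * r) ^ CARD('n))"
    by (auto dest: eventually_happens)
  let ?U = "box (a - vec r) (\<chi> i. a $ i - r + (l + 2 * r))"
  have "t < HL_maximal f y" if "y \<in> ?U" for y
  proof -
    have y: "y \<in> cube (a - vec r) (l + 2 * r)"
      using that by (simp add: mem_box_cart mem_cube_minus_vec less_imp_le)
    have sub: "cube a l \<subseteq> cube (a - vec r) (l + 2 * r)"
    proof
      fix u assume "u \<in> cube a l"
      then show "u \<in> cube (a - vec r) (l + 2 * r)"
        using r l unfolding mem_cube_minus_vec unfolding mem_cube by (smt (verit))
    qed
    have "I \<le> (\<integral>\<^sup>+y\<in>cube (a - vec r) (l + 2 * r). ennreal \<bar>f y\<bar> \<partial>lebesgue)"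
      unfolding I_def using sub by (intro nn_integral_mono) (auto split: split_indicator)
    also have "\<dots> \<le> ennreal ((l + 2 * r) ^ CARD('n)) * HL_maximal f y"
      using l r y by (intro HL_maximal_ge) auto
    finally have "I / ennreal ((l + 2 * r) ^ CARD('n)) \<le> HL_maximal f y"
      using l r by (intro divide_le_posI_ennreal) (auto simp: mult.commute)
    with r show ?thesis by simp
  qed
  moreover have "x \<in> ?U"
  proof -
    have "a $ i - r < x $ i \<and> x $ i < a $ i - r + (l + 2 * r)" for i
      using x[unfolded mem_cube, rule_format, of i] r l by linarith
    then show ?thesis by (simp add: mem_box_cart)
  qed
  ultimately show "\<exists>T. open T \<and> x \<in> T \<and> T \<subseteq> {x. t < HL_maximal f x}"
    by (intro exI[of _ ?U]) auto
qed

lemma borel_measurable_HL_maximal [measurable]: "HL_maximal f \<in> borel_measurable lebesgue"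
proof -
  have "HL_maximal f \<in> borel_measurable borel"
    using open_HL_maximal_greater[of _ f] by (intro borel_measurableI_greater) auto
  then show ?thesis
    by (intro measurable_completion) simp
qed

section \<open>The maximal function of the indicator of a cube\<close>

lemma nn_integral_indicator_Int:
  assumes "Q \<in> sets M" "P \<in> sets M"
  shows "(\<integral>\<^sup>+y\<in>P. ennreal (indicator Q y) \<partial>M) = emeasure M (P \<inter> Q)"
proof -
  have "(\<integral>\<^sup>+y\<in>P. ennreal (indicator Q y) \<partial>M) = (\<integral>\<^sup>+y. indicator (P \<inter> Q) y \<partial>M)"
    by (intro nn_integral_cong) (auto split: split_indicator)
  also have "\<dots> = emeasure M (P \<inter> Q)"
    using assms by (intro nn_integral_indicator) auto
  finally show ?thesis .
qed

lemma HL_indicator_ge: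
  fixes x :: "real ^ 'n"
  assumes "0 \<le> l" "0 < s" "x \<in> cube b s" "cube a l \<subseteq> cube b s"
  shows "ennreal ((l / s) ^ CARD('n)) \<le> HL_maximal (indicator (cube a l)) x"
proof -
  have "ennreal (s ^ CARD('n)) * ennreal ((l / s) ^ CARD('n)) = emeasure lebesgue (cube b s \<inter> cube a l)"
    using assms by (simp add: Int_absorb1 emeasure_cube ennreal_mult[symmetric] power_divide)
  also have "\<dots> \<le> ennreal (s ^ CARD('n)) * HL_maximal (indicator (cube a l)) x"
    using HL_maximal_ge[OF assms(2,3), of "indicator (cube a l)"]
    by (simp add: nn_integral_indicator_Int)
  finally show ?thesis
    using assms by (subst (asm) ennreal_mult_le_mult_iff) auto
qed

text \<open>A test cube of side \<open>s\<close> that misses \<open>cube a l\<close> contributes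
  average 0; one that meets it contributes at most the minimum of 1 and the ratio of the volumes.
  Upper bounds thus reduce to geometry of the test cubes that meet \<open>cube a l\<close>.\<close>

lemma HL_indicator_le:
  fixes x :: "real ^ 'n"
  assumes "0 \<le> l" "0 \<le> C"
    and "\<And>b s. 0 < s \<Longrightarrow> x \<in> cube b s \<Longrightarrow> cube b s \<inter> cube a l \<noteq> {} \<Longrightarrow>
      min 1 ((l / s) ^ CARD('n)) \<le> C"
  shows "HL_maximal (indicator (cube a l)) x \<le> ennreal C"
proof (rule HL_maximal_le)
  fix b :: "real ^ 'n" and s :: real assume s: "0 < s" "x \<in> cube b s"
  have "emeasure lebesgue (cube b s \<inter> cube a l) \<le> ennreal (s ^ CARD('n)) * ennreal C"
  proof (cases "cube b s \<inter> cube a l = {}")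
    case False
    have "emeasure lebesgue (cube b s \<inter> cube a l) \<le> emeasure lebesgue (cube b s)"
      by (intro emeasure_mono) auto
    moreover have "emeasure lebesgue (cube b s \<inter> cube a l) \<le> emeasure lebesgue (cube a l)"
      by (intro emeasure_mono) auto
    ultimately have "emeasure lebesgue (cube b s \<inter> cube a l) \<le> ennreal (min (s ^ CARD('n)) (l ^ CARD('n)))"
      using s assms by (auto simp: emeasure_cube min_def)
    also have "min (s ^ CARD('n)) (l ^ CARD('n)) = s ^ CARD('n) * min 1 ((l / s) ^ CARD('n))"
      using s by (auto simp: power_divide min_def field_simps)
    also have "\<dots> \<le> s ^ CARD('n) * C"
      using s assms(3)[OF s False] by (intro mult_left_mono) auto
    finally show ?thesis using s assms by (simp add: ennreal_mult[symmetric] ennreal_leI)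
  qed simp
  then show "(\<integral>\<^sup>+y\<in>cube b s. ennreal \<bar>indicator (cube a l) y\<bar> \<partial>lebesgue) \<le> ennreal (s ^ CARD('n)) * ennreal C"
    by (simp add: nn_integral_indicator_Int)
qed

lemma HL_indicator_le_1: "0 \<le> l \<Longrightarrow> HL_maximal (indicator (cube a l)) x \<le> 1"
  using HL_indicator_le[of l 1 x a] by simp

lemma HL_indicator_finite:
  assumes "0 \<le> l"
  obtains m where "0 \<le> m" "HL_maximal (indicator (cube a l)) x = ennreal m"
proof -
  have "HL_maximal (indicator (cube a l)) x < \<infinity>"
    using HL_indicator_le_1[OF assms, of a x] by (rule le_less_trans) simp
  then show thesis
    using that[of "enn2real (HL_maximal (indicator (cube a l)) x)"] by simp
qed

text \<open>In some coordinate the point is more than \<open>r\<close> away from the cube, so every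
  test cube that contains the point and meets the cube has side at least \<open>r\<close>.\<close>

lemma HL_indicator_off_neighbourhood:
  fixes x :: "real ^ 'n"
  assumes "0 < l" "0 < r" "x \<notin> cube (a - vec r) (l + 2 * r)"
  shows "HL_maximal (indicator (cube a l)) x \<le> ennreal ((l / r) ^ CARD('n))"
proof (rule HL_indicator_le)
  fix b :: "real ^ 'n" and s :: real
  assume s: "0 < s" "x \<in> cube b s" "cube b s \<inter> cube a l \<noteq> {}"
  then obtain y where y: "y \<in> cube b s" "y \<in> cube a l" by auto
  obtain i where i: "\<not> (a $ i - r \<le> x $ i \<and> x $ i \<le> a $ i - r + (l + 2 * r))"
    using assms(3) unfolding mem_cube_minus_vec by blast
  have "r \<le> s"
    using i s(2)[unfolded mem_cube, rule_format, of i] y[unfolded mem_cube, rule_format, of i] by linarith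
  then have "(l / s) ^ CARD('n) \<le> (l / r) ^ CARD('n)"
    using assms by (intro power_mono divide_left_mono) auto
  then show "min 1 ((l / s) ^ CARD('n)) \<le> (l / r) ^ CARD('n)" by simp
qed (use assms in auto)

text \<open>Since the point is outside the threefold dilate of the large cube, a test cube that
  meets the small one has side \<open>s \<ge> l\<close>. Widened by \<open>l\<close> on each side it
  contains the large cube, and its side \<open>s + 2 * l\<close> is at most \<open>3 * s\<close>.
  This is the factor 3; the ratio of the volumes of the two cubes remains as the gain.\<close>

lemma HL_indicator_subcube_far:
  fixes x :: "real ^ 'n"
  assumes "0 < l'" "0 < l" "cube a' l' \<subseteq> cube a l" "x \<notin> cube (a - vec l) (3 * l)"
  shows "HL_maximal (indicator (cube a' l')) x
    \<le> ennreal ((3 * l' / l) ^ CARD('n)) * HL_maximal (indicator (cube a l)) x"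
proof -
  obtain m where m: "0 \<le> m" "HL_maximal (indicator (cube a l)) x = ennreal m"
    using assms by (auto intro: HL_indicator_finite[of l a x])
  have "HL_maximal (indicator (cube a' l')) x \<le> ennreal ((3 * l' / l) ^ CARD('n) * m)"
  proof (rule HL_indicator_le)
    fix b :: "real ^ 'n" and s :: real
    assume s: "0 < s" "x \<in> cube b s" "cube b s \<inter> cube a' l' \<noteq> {}"
    then obtain y where y: "y \<in> cube b s" "y \<in> cube a l" using assms by auto
    obtain i where i: "\<not> (a $ i - l \<le> x $ i \<and> x $ i \<le> a $ i - l + 3 * l)"
      using assms(4) unfolding mem_cube_minus_vec by blast
    have "l \<le> s"
      using i s(2)[unfolded mem_cube, rule_format, of i] y[unfolded mem_cube, rule_format, of i] by linarith
    have "cube a l \<subseteq> cube (b - vec l) (s + 2 * l)"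
    proof
      fix u assume "u \<in> cube a l"
      then show "u \<in> cube (b - vec l) (s + 2 * l)"
        using y unfolding mem_cube_minus_vec unfolding mem_cube by (smt (verit))
    qed
    moreover have "x \<in> cube (b - vec l) (s + 2 * l)"
      using s(2) assms unfolding mem_cube_minus_vec unfolding mem_cube by (smt (verit))
    ultimately have lm: "(l / (s + 2 * l)) ^ CARD('n) \<le> m"
      using HL_indicator_ge[of l "s + 2 * l" x "b - vec l" a] assms s m by simp
    have "l' / s \<le> 3 * l' / l * (l / (s + 2 * l))"
      using \<open>l \<le> s\<close> assms s by (simp add: field_simps)
    then have "(l' / s) ^ CARD('n) \<le> (3 * l' / l * (l / (s + 2 * l))) ^ CARD('n)"
      using assms s by (intro power_mono) auto
    also have "\<dots> = (3 * l' / l) ^ CARD('n) * (l / (s + 2 * l)) ^ CARD('n)"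
      by (rule power_mult_distrib)
    also have "\<dots> \<le> (3 * l' / l) ^ CARD('n) * m"
      using assms by (intro mult_left_mono lm) auto
    finally show "min 1 ((l' / s) ^ CARD('n)) \<le> (3 * l' / l) ^ CARD('n) * m" by simp
  qed (use assms m in auto)
  then show ?thesis using assms m by (simp add: ennreal_mult)
qed

text \<open>A test cube that meets the threefold dilate contains the original cube once it is
  widened by \<open>2 * l\<close> on each side.\<close>

lemma HL_indicator_dilate:
  fixes x :: "real ^ 'n"
  assumes "0 < l"
  shows "HL_maximal (indicator (cube (a - vec l) (3 * l))) x
    \<le> ennreal (15 ^ CARD('n)) * HL_maximal (indicator (cube a l)) x"
proof -
  obtain m where m: "0 \<le> m" "HL_maximal (indicator (cube a l)) x = ennreal m"
    using assms by (auto intro: HL_indicator_finite[of l a x])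
  have "HL_maximal (indicator (cube (a - vec l) (3 * l))) x \<le> ennreal (15 ^ CARD('n) * m)"
  proof (rule HL_indicator_le)
    fix b :: "real ^ 'n" and s :: real
    assume s: "0 < s" "x \<in> cube b s" "cube b s \<inter> cube (a - vec l) (3 * l) \<noteq> {}"
    then obtain y where y: "y \<in> cube b s" "y \<in> cube (a - vec l) (3 * l)" by auto
    have "cube a l \<subseteq> cube (b - vec (2 * l)) (s + 4 * l)"
    proof
      fix u assume "u \<in> cube a l"
      then show "u \<in> cube (b - vec (2 * l)) (s + 4 * l)"
        using y unfolding mem_cube_minus_vec unfolding mem_cube by (smt (verit))
    qed
    moreover have "x \<in> cube (b - vec (2 * l)) (s + 4 * l)"
      using s(2) assms unfolding mem_cube_minus_vec unfolding mem_cube by (smt (verit))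
    ultimately have lm: "(l / (s + 4 * l)) ^ CARD('n) \<le> m"
      using HL_indicator_ge[of l "s + 4 * l" x "b - vec (2 * l)" a] assms s m by simp
    \<comment> \<open>For \<open>l \<le> s\<close> the widened side \<open>s + 4 * l\<close> is at
      most \<open>5 * s\<close>, which gives 15 = 3 * 5. For \<open>s < l\<close> it is below
      \<open>5 * l\<close>, and the right-hand side exceeds 1.\<close>
    have "min 1 (3 * l / s) \<le> 15 * (l / (s + 4 * l))"
    proof (cases "l \<le> s")
      case True
      then have "3 * l / s \<le> 15 * (l / (s + 4 * l))"
        using assms s by (simp add: field_simps)
      then show ?thesis by simp
    next
      case False
      then have "1 \<le> 15 * (l / (s + 4 * l))"
        using assms s by (simp add: field_simps)
      then show ?thesis by simp
    qed
    then have "(min 1 (3 * l / s)) ^ CARD('n) \<le> (15 * (l / (s + 4 * l))) ^ CARD('n)"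
      using assms s by (intro power_mono) auto
    also have "\<dots> = 15 ^ CARD('n) * (l / (s + 4 * l)) ^ CARD('n)"
      by (rule power_mult_distrib)
    also have "\<dots> \<le> 15 ^ CARD('n) * m"
      by (intro mult_left_mono lm) auto
    finally show "min 1 ((3 * l / s) ^ CARD('n)) \<le> 15 ^ CARD('n) * m"
      by (auto simp: min_def split: if_splits)
  qed (use assms m in auto)
  then show ?thesis using m by (simp add: ennreal_mult)
qed

subsection \<open>The tail functional\<close>

lemma epowr_ennreal: "0 \<le> m \<Longrightarrow> epowr (ennreal m) p = ennreal (m powr p)"
  by (simp add: epowr_def)

lemma epowr_mono:
  assumes "0 \<le> p" "x \<le> y"
  shows "epowr x p \<le> epowr y p"
proof (cases "y = \<infinity>")
  case False
  then have "x \<noteq> \<infinity>" using assms by (auto simp: top_unique)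
  with False show ?thesis
    using assms by (auto simp: epowr_def less_top intro!: ennreal_leI powr_mono2 enn2real_mono)
qed (simp add: epowr_def)

lemma epowr_le_mult:
  assumes "x \<le> ennreal c * ennreal m" "0 \<le> c" "0 \<le> m" "0 \<le> p"
  shows "epowr x p \<le> ennreal (c powr p) * epowr (ennreal m) p"
proof -
  have "epowr x p \<le> epowr (ennreal (c * m)) p"
    using assms by (intro epowr_mono) (auto simp: ennreal_mult)
  also have "\<dots> = ennreal (c powr p) * epowr (ennreal m) p"
    using assms by (subst epowr_ennreal) (simp_all add: epowr_ennreal powr_mult ennreal_mult)
  finally show ?thesis .
qed

lemma borel_measurable_epowr [measurable (raw)]:
  assumes f [measurable]: "f \<in> borel_measurable M"
  shows "(\<lambda>x. epowr (f x) p) \<in> borel_measurable M"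
proof -
  have "{x \<in> space M. f x = \<infinity>} = f -` {\<infinity>} \<inter> space M" by auto
  also have "\<dots> \<in> sets M" by (rule measurable_sets[OF f]) simp
  finally show ?thesis
    unfolding epowr_def
    by (intro measurable_If measurable_const measurable_compose[OF _ measurable_ennreal]
        powr_real_measurable measurable_compose[OF f borel_measurable_enn2real]) auto
qed

lemma borel_measurable_weight: "weight w \<Longrightarrow> w \<in> borel_measurable lebesgue"
  by (simp add: weight_def)

lemma weight_nonneg: "weight w \<Longrightarrow> 0 \<le> w x"
  by (simp add: weight_def)

lemma borel_measurable_Cp_tail_integrand:
  "weight w \<Longrightarrow> (\<lambda>x. epowr (HL_maximal f x) p * ennreal (w x)) \<in> borel_measurable lebesgue"
  by (intro borel_measurable_times_ennreal borel_measurable_epowr borel_measurable_HL_maximal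
      measurable_compose[OF _ measurable_ennreal] borel_measurable_weight)

lemma Cp_tail_mono:
  assumes "0 \<le> p" "Q \<subseteq> Q'"
  shows "Cp_tail p w Q \<le> Cp_tail p w Q'"
  unfolding Cp_tail_def using assms
  by (intro nn_integral_mono mult_right_mono epowr_mono HL_maximal_mono)
    (auto split: split_indicator)

text \<open>On the large cube the maximal function of the small one is at least
  \<open>(l / s) ^ CARD('n)\<close>. With equal cubes the constant is 1; the threefold dilate is the
  case needed for differentiation.\<close>

lemma wmeasure_le_Cp_tail:
  fixes a :: "real ^ 'n"
  assumes w: "weight w" and p: "0 \<le> p" and l: "0 < l" "0 < s" and sub: "cube a l \<subseteq> cube b s"
  shows "wmeasure w (cube b s) \<le> ennreal (((s / l) ^ CARD('n)) powr p) * Cp_tail p w (cube a l)"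
proof -
  let ?c = "((s / l) ^ CARD('n)) powr p"
  have "ennreal (w x) \<le> ennreal ?c * (epowr (HL_maximal (indicator (cube a l)) x) p * ennreal (w x))"
    if "x \<in> cube b s" for x
  proof -
    have "1 = ?c * ((l / s) ^ CARD('n)) powr p"
      using l by (simp add: powr_mult[symmetric] power_mult_distrib[symmetric])
    then have "1 = ennreal ?c * epowr (ennreal ((l / s) ^ CARD('n))) p"
      using l by (simp add: epowr_ennreal ennreal_mult[symmetric])
    also have "\<dots> \<le> ennreal ?c * epowr (HL_maximal (indicator (cube a l)) x) p"
      using l p that sub by (intro mult_left_mono epowr_mono HL_indicator_ge) auto
    finally have "1 * ennreal (w x)
        \<le> ennreal ?c * epowr (HL_maximal (indicator (cube a l)) x) p * ennreal (w x)"
      by (rule mult_right_mono) simp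
    then show ?thesis by (simp add: mult.assoc)
  qed
  then have "wmeasure w (cube b s)
      \<le> (\<integral>\<^sup>+x. ennreal ?c * (epowr (HL_maximal (indicator (cube a l)) x) p * ennreal (w x)) \<partial>lebesgue)"
    unfolding wmeasure_def
    by (intro nn_integral_mono) (auto split: split_indicator)
  also have "\<dots> = ennreal ?c * Cp_tail p w (cube a l)"
    unfolding Cp_tail_def
    by (intro nn_integral_cmult borel_measurable_Cp_tail_integrand w)
  finally show ?thesis .
qed

text \<open>\<open>HL_indicator_dilate\<close> raised to the power \<open>p\<close> and integrated.
  It leads back to the original cube after the C_p constant has been applied to the threefold
  dilate.\<close>

lemma Cp_tail_dilate:
  fixes a :: "real ^ 'n"
  assumes w: "weight w" and p: "0 \<le> p" and l: "0 < l"
  shows "Cp_tail p w (cube (a - vec l) (3 * l)) \<le> ennreal ((15 ^ CARD('n)) powr p) * Cp_tail p w (cube a l)"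
proof -
  have "epowr (HL_maximal (indicator (cube (a - vec l) (3 * l))) x) p
    \<le> ennreal ((15 ^ CARD('n)) powr p) * epowr (HL_maximal (indicator (cube a l)) x) p" for x
  proof -
    obtain m where m: "0 \<le> m" "HL_maximal (indicator (cube a l)) x = ennreal m"
      using l by (auto intro: HL_indicator_finite[of l a x])
    show ?thesis
      using HL_indicator_dilate[OF l, of a x] p m
      unfolding m by (intro epowr_le_mult) auto
  qed
  then have "Cp_tail p w (cube (a - vec l) (3 * l))
      \<le> (\<integral>\<^sup>+x. ennreal ((15 ^ CARD('n)) powr p) *
          (epowr (HL_maximal (indicator (cube a l)) x) p * ennreal (w x)) \<partial>lebesgue)"
    unfolding Cp_tail_def
    by (intro nn_integral_mono) (auto simp: mult.assoc[symmetric] intro: mult_right_mono)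
  also have "\<dots> = ennreal ((15 ^ CARD('n)) powr p) * Cp_tail p w (cube a l)"
    unfolding Cp_tail_def
    by (intro nn_integral_cmult borel_measurable_Cp_tail_integrand w)
  finally show ?thesis .
qed

section \<open>The tail of a subcube: near part and far part\<close>

lemma cube_subset_side_le:
  assumes "0 \<le> l'" "cube a' l' \<subseteq> cube a l"
  shows "l' \<le> l"
proof -
  have "a' \<in> cube a' l'" "a' + vec l' \<in> cube a' l'"
    using assms by (simp_all add: mem_cube)
  then have "a' \<in> cube a l" "a' + vec l' \<in> cube a l" using assms by auto
  then show ?thesis
    unfolding mem_cube by (force dest!: spec[of _ undefined])
qed

lemma mem_cube_large_neighbourhood:
  fixes a x :: "real ^ 'n"
  assumes "0 < l"
  obtains k where "x \<in> cube (a - vec (2 ^ k * l)) (l + 2 * (2 ^ k * l))"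
proof -
  obtain k where "norm (x - a) / l < 2 ^ k"
    using real_arch_pow[of 2 "norm (x - a) / l"] by auto
  then have k: "norm (x - a) \<le> 2 ^ k * l"
    using assms by (simp add: field_simps)
  have "x \<in> cube (a - vec (2 ^ k * l)) (l + 2 * (2 ^ k * l))"
    unfolding mem_cube_minus_vec
  proof
    fix i
    have "\<bar>x $ i - a $ i\<bar> \<le> 2 ^ k * l"
      using component_le_norm_cart[of "x - a" i] k by simp
    then have "x $ i - a $ i \<le> 2 ^ k * l" "a $ i - x $ i \<le> 2 ^ k * l"
      by (auto simp: abs_le_iff)
    then show "a $ i - 2 ^ k * l \<le> x $ i \<and> x $ i \<le> a $ i - 2 ^ k * l + (l + 2 * (2 ^ k * l))"
      using assms by linarith
  qed
  then show thesis by (rule that)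
qed

text \<open>The annuli around the cube at scale \<open>2\<^sup>k\<close> have measure \<open>\<approx> 2\<^sup>k\<^sup>n\<close>, whereas the maximal function
  of the cube, raised to \<open>p\<close>, is at most \<open>2\<^sup>-\<^sup>k\<^sup>n\<^sup>p\<close> there.\<close>

definition near_const :: "'n::finite itself \<Rightarrow> real \<Rightarrow> real" where
  "near_const _ p = (2 ^ CARD('n)) powr p * 4 ^ CARD('n) / (1 - ((1 / 2) ^ CARD('n)) powr (p - 1))"

lemma half_powr_less_1: "1 < p \<Longrightarrow> ((1 / 2) ^ CARD('n::finite)) powr (p - 1) < (1::real)"
  using powr_less_mono2[of "p - 1" "(1 / 2) ^ CARD('n)" 1] by (simp add: power_less_one_iff)

lemma near_const_nonneg: "1 < p \<Longrightarrow> 0 \<le> near_const TYPE('n::finite) p"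
  using half_powr_less_1[of p, where 'n='n] by (simp add: near_const_def)

text \<open>Only the smallest neighbourhood that contains the point is used; the other terms are
  nonnegative. The sum runs over full cubes instead of annuli, because all of these cubes contain
  \<open>cube a l\<close> and can serve as test cubes for a maximal function at its points.\<close>

lemma HL_indicator_powr_le_annuli:
  fixes a :: "real ^ 'n"
  assumes p: "1 < p" and l: "0 < l"
  shows "epowr (HL_maximal (indicator (cube a l)) x) p \<le>
    (\<Sum>k. ennreal ((2 ^ CARD('n)) powr p * (((1 / 2) ^ CARD('n)) powr p) ^ k) *
          indicator (cube (a - vec (2 ^ k * l)) (l + 2 * (2 ^ k * l))) x)"
    (is "?T \<le> (\<Sum>k. ennreal (?c k) * indicator (?E k) x)")
proof -
  obtain k0 where "x \<in> ?E k0" by (rule mem_cube_large_neighbourhood[OF l])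
  define k where "k = (LEAST k. x \<in> ?E k)"
  have k: "x \<in> ?E k" unfolding k_def by (rule LeastI[of _ k0]) fact
  have "?T \<le> ennreal (?c k)"
  proof (cases k)
    case 0
    have "?T \<le> epowr 1 p"
      using p l by (intro epowr_mono HL_indicator_le_1) auto
    also have "\<dots> = ennreal 1"
      using epowr_ennreal[of 1 p] by simp
    also have "\<dots> \<le> ennreal (?c k)"
      using p by (intro ennreal_leI) (simp add: 0 ge_one_powr_ge_zero)
    finally show ?thesis .
  next
    \<comment> \<open>The point lies outside the neighbourhood of index \<open>k - 1\<close>, not
      \<open>k\<close>; the factor \<open>(2 ^ CARD('n)) powr p\<close> in the coefficients makes up
      for this shift.\<close>
    case (Suc j)
    have "x \<notin> ?E j"
      using not_less_Least[of j "\<lambda>k. x \<in> ?E k"] Suc by (simp add: k_def[symmetric])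
    then have "HL_maximal (indicator (cube a l)) x \<le> ennreal ((l / (2 ^ j * l)) ^ CARD('n))"
      using l by (intro HL_indicator_off_neighbourhood) auto
    then have "?T \<le> epowr (ennreal ((l / (2 ^ j * l)) ^ CARD('n))) p"
      using p by (intro epowr_mono) auto
    also have "\<dots> = ennreal (((l / (2 ^ j * l)) ^ CARD('n)) powr p)"
      using l by (simp add: epowr_ennreal)
    also have "((l / (2 ^ j * l)) ^ CARD('n)) powr p = ?c k"
    proof -
      have pw: "(y ^ j) powr p = (y powr p) ^ j" if "0 \<le> y" for y :: real
        using that by (induction j) (simp_all add: powr_mult)
      have "(l / (2 ^ j * l)) ^ CARD('n) = ((1 / 2) ^ CARD('n)) ^ j"
        using l by (simp add: power_divide power_mult[symmetric] mult.commute)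
      also have "\<dots> powr p = (((1 / 2) ^ CARD('n)) powr p) ^ j"
        by (rule pw) simp
      also have "\<dots> = ((2 ^ CARD('n)) powr p * ((1 / 2) ^ CARD('n)) powr p) * (((1 / 2) ^ CARD('n)) powr p) ^ j"
        by (simp add: powr_mult[symmetric] power_mult_distrib[symmetric])
      finally show ?thesis by (simp add: Suc mult_ac)
    qed
    finally show ?thesis .
  qed
  also have "\<dots> = (\<Sum>j\<in>{k}. ennreal (?c j) * indicator (?E j) x)"
    using k by simp
  also have "\<dots> \<le> (\<Sum>k. ennreal (?c k) * indicator (?E k) x)"
    by (rule sum_le_suminf) auto
  finally show ?thesis .
qed

text \<open>Each neighbourhood \<open>E k\<close> contains \<open>x\<close>, so the integral over it
  is at most its volume times the maximal function at \<open>x\<close>. The volume grows like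
  \<open>2 ^ k\<close> to the dimension while the coefficient decays with the additional exponent
  \<open>p\<close>, which leaves a geometric series of ratio \<open>r < 1\<close>, as
  \<open>p > 1\<close>.\<close>

lemma Cp_tail_near_le:
  fixes a :: "real ^ 'n" and N :: "(real ^ 'n) set"
  assumes w: "weight w" and p: "1 < p" and l: "0 < l" and x: "x \<in> cube a l"
    and N: "N \<in> sets lebesgue"
  shows "(\<integral>\<^sup>+z\<in>N. epowr (HL_maximal (indicator (cube a l)) z) p * ennreal (w z) \<partial>lebesgue)
    \<le> ennreal (l ^ CARD('n)) * (ennreal (near_const TYPE('n) p) *
        HL_maximal (\<lambda>y. indicator N y * w y) x)" (is "?lhs \<le> _ * (_ * ?M)")
proof -

  define c where "c k = (2 ^ CARD('n)) powr p * (((1 / 2) ^ CARD('n)) powr p) ^ k" for k :: nat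
  define E where "E k = cube (a - vec (2 ^ k * l)) (l + 2 * (2 ^ k * l))" for k :: nat
  define r where "r = ((1 / 2) ^ CARD('n)) powr (p - 1)"
  have r: "0 \<le> r" "r < 1" "r = ((1 / 2) ^ CARD('n)) powr p * 2 ^ CARD('n)"
    using half_powr_less_1[OF p, where 'n='n] by (auto simp: r_def powr_diff power_divide)
  have "(\<lambda>z. ennreal \<bar>indicator N z * w z\<bar>) \<in> borel_measurable lebesgue"
    by (intro measurable_compose[OF _ measurable_ennreal] borel_measurable_abs borel_measurable_times
        borel_measurable_indicator N borel_measurable_weight w)
  then have mE: "(\<lambda>z. ennreal \<bar>indicator N z * w z\<bar> * indicator (E k) z) \<in> borel_measurable lebesgue" for k
    by (intro borel_measurable_times_ennreal borel_measurable_indicator) (simp_all add: E_def)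
  have mcE: "(\<lambda>z. ennreal (c k) * (ennreal \<bar>indicator N z * w z\<bar> * indicator (E k) z))
      \<in> borel_measurable lebesgue" for k
    by (intro borel_measurable_times_ennreal mE borel_measurable_const)
  have "?lhs \<le> (\<integral>\<^sup>+z. (\<Sum>k. ennreal (c k) * (ennreal \<bar>indicator N z * w z\<bar> * indicator (E k) z)) \<partial>lebesgue)"
  proof (rule nn_integral_mono)
    fix z
    have "epowr (HL_maximal (indicator (cube a l)) z) p * ennreal (w z) * indicator N z
        \<le> (\<Sum>k. ennreal (c k) * indicator (E k) z) * (ennreal (w z) * indicator N z)"
      unfolding mult.assoc c_def E_def
      by (intro mult_right_mono HL_indicator_powr_le_annuli p l) auto
    also have "\<dots> = (\<Sum>k. ennreal (c k) * indicator (E k) z * (ennreal (w z) * indicator N z))"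
      by (rule ennreal_suminf_multc[symmetric])
    also have "\<dots> = (\<Sum>k. ennreal (c k) * (ennreal \<bar>indicator N z * w z\<bar> * indicator (E k) z))"
      using weight_nonneg[OF w, of z] by (intro suminf_cong) (auto split: split_indicator)
    finally show "epowr (HL_maximal (indicator (cube a l)) z) p * ennreal (w z) * indicator N z
        \<le> (\<Sum>k. ennreal (c k) * (ennreal \<bar>indicator N z * w z\<bar> * indicator (E k) z))" .
  qed
  also have "\<dots> = (\<Sum>k. ennreal (c k) * (\<integral>\<^sup>+z\<in>E k. ennreal \<bar>indicator N z * w z\<bar> \<partial>lebesgue))"
    by (simp only: nn_integral_suminf[OF mcE] nn_integral_cmult[OF mE])
  also have "\<dots> \<le> (\<Sum>k. ennreal (l ^ CARD('n) * ((2 ^ CARD('n)) powr p * 4 ^ CARD('n)) * r ^ k) * ?M)"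
  proof (intro suminf_le allI)
    fix k :: nat
    have "x \<in> E k"
    proof -
      have "0 < 2 ^ k * l" using l by simp
      then show ?thesis
        using x l unfolding E_def mem_cube_minus_vec unfolding mem_cube by (smt (verit))
    qed
    then have "(\<integral>\<^sup>+z\<in>E k. ennreal \<bar>indicator N z * w z\<bar> \<partial>lebesgue)
        \<le> ennreal ((l + 2 * (2 ^ k * l)) ^ CARD('n)) * ?M"
      unfolding E_def using l by (intro HL_maximal_ge) (auto intro: add_pos_pos)
    also have "\<dots> \<le> ennreal ((4 * 2 ^ k * l) ^ CARD('n)) * ?M"
    proof (intro mult_right_mono ennreal_leI power_mono)
      have "1 * l \<le> 2 ^ k * l" using l by (intro mult_right_mono) auto
      then show "l + 2 * (2 ^ k * l) \<le> 4 * 2 ^ k * l" using l by linarith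
    qed (use l in auto)
    finally have "ennreal (c k) * (\<integral>\<^sup>+z\<in>E k. ennreal \<bar>indicator N z * w z\<bar> \<partial>lebesgue)
        \<le> ennreal (c k) * (ennreal ((4 * 2 ^ k * l) ^ CARD('n)) * ?M)"
      by (intro mult_left_mono) auto
    also have "\<dots> = ennreal (c k * (4 * 2 ^ k * l) ^ CARD('n)) * ?M"
      using l by (simp add: ennreal_mult mult.assoc c_def)
    also have "c k * (4 * 2 ^ k * l) ^ CARD('n) = l ^ CARD('n) * ((2 ^ CARD('n)) powr p * 4 ^ CARD('n)) * r ^ k"
    proof -
      have "(4 * 2 ^ k * l) ^ CARD('n) = 4 ^ CARD('n) * (2 ^ CARD('n)) ^ k * l ^ CARD('n)"
        by (simp only: power_mult_distrib power_mult[symmetric] mult.commute[of k])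
      then show ?thesis
        unfolding r(3) c_def by (simp only: power_mult_distrib mult_ac)
    qed
    finally show "ennreal (c k) * (\<integral>\<^sup>+z\<in>E k. ennreal \<bar>indicator N z * w z\<bar> \<partial>lebesgue)
        \<le> ennreal (l ^ CARD('n) * ((2 ^ CARD('n)) powr p * 4 ^ CARD('n)) * r ^ k) * ?M" .
  qed auto
  also have "\<dots> = (\<Sum>k. ennreal (l ^ CARD('n) * ((2 ^ CARD('n)) powr p * 4 ^ CARD('n)) * r ^ k)) * ?M"
    by (rule ennreal_suminf_multc)
  also have "(\<Sum>k. ennreal (l ^ CARD('n) * ((2 ^ CARD('n)) powr p * 4 ^ CARD('n)) * r ^ k))
      = ennreal (l ^ CARD('n) * ((2 ^ CARD('n)) powr p * 4 ^ CARD('n)) * (1 / (1 - r)))"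
    using l r by (intro suminf_ennreal_eq sums_mult geometric_sums) auto
  also have "\<dots> * ?M = ennreal (l ^ CARD('n)) * (ennreal (near_const TYPE('n) p) * ?M)"
    using l near_const_nonneg[OF p, where 'n='n]
    by (simp add: mult.assoc[symmetric] ennreal_mult[symmetric] near_const_def r_def)
  finally show ?thesis .
qed

text \<open>The integral is split at the threefold dilate of the large cube:
  \<open>Cp_tail_near_le\<close> handles the inside and \<open>HL_indicator_subcube_far\<close> the
  outside. Dividing by the volume of the small cube bounds its tail average by a maximal function at
  any of its points plus a multiple of the tail average of the large cube.\<close>

lemma Cp_tail_subcube_le:
  fixes a :: "real ^ 'n"
  assumes w: "weight w" and p: "1 < p" and l: "0 < l" "0 < l'"
    and sub: "cube a' l' \<subseteq> cube a l" and x: "x \<in> cube a' l'"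
  shows "Cp_tail p w (cube a' l') \<le> ennreal (l' ^ CARD('n)) *
      (ennreal (near_const TYPE('n) p) *
         HL_maximal (\<lambda>y. indicator (cube (a - vec l) (3 * l)) y * w y) x
       + ennreal ((3 ^ CARD('n)) powr p) * (Cp_tail p w (cube a l) / ennreal (l ^ CARD('n))))"
proof -
  let ?N = "cube (a - vec l) (3 * l)"
  let ?T = "\<lambda>Q x. epowr (HL_maximal (indicator Q) x) p"
  let ?b = "(3 ^ CARD('n)) powr p * (l' / l) ^ CARD('n)"
  have far: "?T (cube a' l') z * ennreal (w z) * indicator (- ?N) z
      \<le> ennreal ?b * (?T (cube a l) z * ennreal (w z))" for z
  proof (cases "z \<in> ?N")
    case False
    obtain m where m: "0 \<le> m" "HL_maximal (indicator (cube a l)) z = ennreal m"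
      using l by (auto intro: HL_indicator_finite[of l a z])
    have ll: "l' \<le> l" using l sub by (intro cube_subset_side_le[of l' a' a]) auto
    have "?T (cube a' l') z \<le> ennreal (((3 * l' / l) ^ CARD('n)) powr p) * ?T (cube a l) z"
      unfolding m(2) using p l m HL_indicator_subcube_far[OF l(2,1) sub False]
      by (intro epowr_le_mult) auto
    also have "((3 * l' / l) ^ CARD('n)) powr p = (3 ^ CARD('n)) powr p * ((l' / l) ^ CARD('n)) powr p"
      using l by (simp add: powr_mult[symmetric] power_mult_distrib[symmetric])
    \<comment> \<open>The ratio of volumes is at most 1 and \<open>p\<close> exceeds 1, so the
      exponent can be lowered to 1. Exactly the volume of the small cube over that of the large one
      is left.\<close>
    also have "ennreal \<dots> \<le> ennreal ?b"
    proof (intro ennreal_leI mult_left_mono)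
      have "((l' / l) ^ CARD('n)) powr p \<le> ((l' / l) ^ CARD('n)) powr 1"
        using l ll p by (intro powr_mono') (auto intro!: power_le_one)
      then show "((l' / l) ^ CARD('n)) powr p \<le> (l' / l) ^ CARD('n)" using l by simp
    qed auto
    finally show ?thesis
      using False by (simp add: mult.assoc[symmetric] mult_right_mono)
  qed simp
  have "Cp_tail p w (cube a' l') =
      (\<integral>\<^sup>+z. ?T (cube a' l') z * ennreal (w z) * indicator ?N z
         + ?T (cube a' l') z * ennreal (w z) * indicator (- ?N) z \<partial>lebesgue)"
    unfolding Cp_tail_def by (intro nn_integral_cong) (auto split: split_indicator)
  also have "\<dots> = (\<integral>\<^sup>+z\<in>?N. ?T (cube a' l') z * ennreal (w z) \<partial>lebesgue)
      + (\<integral>\<^sup>+z. ?T (cube a' l') z * ennreal (w z) * indicator (- ?N) z \<partial>lebesgue)"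
    by (intro nn_integral_add borel_measurable_times_ennreal borel_measurable_Cp_tail_integrand w
        borel_measurable_indicator) (auto simp: Compl_in_sets_lebesgue)
  also have "\<dots> \<le> ennreal (l' ^ CARD('n)) * (ennreal (near_const TYPE('n) p) *
         HL_maximal (\<lambda>y. indicator ?N y * w y) x) + ennreal ?b * Cp_tail p w (cube a l)"
  proof (intro add_mono Cp_tail_near_le w p l x)
    have "(\<integral>\<^sup>+z. ?T (cube a' l') z * ennreal (w z) * indicator (- ?N) z \<partial>lebesgue)
        \<le> (\<integral>\<^sup>+z. ennreal ?b * (?T (cube a l) z * ennreal (w z)) \<partial>lebesgue)"
      by (intro nn_integral_mono far)
    also have "\<dots> = ennreal ?b * Cp_tail p w (cube a l)"
      unfolding Cp_tail_def by (intro nn_integral_cmult borel_measurable_Cp_tail_integrand w)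
    finally show "(\<integral>\<^sup>+z. ?T (cube a' l') z * ennreal (w z) * indicator (- ?N) z \<partial>lebesgue)
        \<le> ennreal ?b * Cp_tail p w (cube a l)" .
  qed auto
  also have "ennreal ?b * Cp_tail p w (cube a l)
      = ennreal (l' ^ CARD('n)) * (ennreal ((3 ^ CARD('n)) powr p) * (Cp_tail p w (cube a l) / ennreal (l ^ CARD('n))))"
  proof -
    have "ennreal ?b = ennreal (l' ^ CARD('n)) * ennreal ((3 ^ CARD('n)) powr p) * inverse (ennreal (l ^ CARD('n)))"
      using l by (simp add: inverse_ennreal ennreal_mult[symmetric] power_mult_distrib power_inverse
          divide_inverse mult_ac)
    then show ?thesis by (simp add: divide_ennreal_def mult_ac)
  qed
  finally show ?thesis by (simp add: distrib_left)
qed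

subsection \<open>Dyadic subcubes\<close>

text \<open>Half-open, so that the children partition the parent exactly and the
  \<open>w\<close>-mass is additive over them. The tails are taken over the closed cubes.\<close>

definition half_cube :: "(real ^ 'n) \<times> real \<Rightarrow> (real ^ 'n) set" where
  "half_cube R = {x. \<forall>i. fst R $ i \<le> x $ i \<and> x $ i < fst R $ i + snd R}"

abbreviation closed_cube :: "(real ^ 'n) \<times> real \<Rightarrow> (real ^ 'n) set" where
  "closed_cube R \<equiv> cube (fst R) (snd R)"

text \<open>The index \<open>S\<close> is the set of coordinates in which the upper half is chosen;
  this gives 2^n children.\<close>

definition child_cube :: "(real ^ 'n) \<times> real \<Rightarrow> 'n set \<Rightarrow> (real ^ 'n) \<times> real" where
  "child_cube R S = (fst R + (\<chi> i. if i \<in> S then snd R / 2 else 0), snd R / 2)"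

text \<open>For a point of \<open>half_cube R\<close>, the index of the child that contains
  it.\<close>

definition upper_half :: "(real ^ 'n) \<times> real \<Rightarrow> real ^ 'n \<Rightarrow> 'n set" where
  "upper_half R x = {i. fst R $ i + snd R / 2 \<le> x $ i}"

lemma snd_child_cube [simp]: "snd (child_cube R S) = snd R / 2"
  by (simp add: child_cube_def)

lemma half_cube_subset: "half_cube R \<subseteq> closed_cube R"
  by (auto simp: half_cube_def mem_cube less_imp_le)

lemma child_cube_subset:
  assumes "0 < snd R"
  shows "closed_cube (child_cube R S) \<subseteq> closed_cube R"
proof
  fix x assume x: "x \<in> closed_cube (child_cube R S)"
  have "fst R $ i \<le> x $ i \<and> x $ i \<le> fst R $ i + snd R" for i
    using x[unfolded mem_cube, rule_format, of i] assms
    by (auto simp: child_cube_def split: if_splits)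
  then show "x \<in> closed_cube R" by (simp add: mem_cube)
qed

lemma mem_half_cube_child:
  assumes "0 < snd R"
  shows "x \<in> half_cube (child_cube R S) \<longleftrightarrow> x \<in> half_cube R \<and> S = upper_half R x"
proof (intro iffI conjI)
  assume x: "x \<in> half_cube (child_cube R S)"
  have i: "fst R $ i + (if i \<in> S then snd R / 2 else 0) \<le> x $ i"
    "x $ i < fst R $ i + (if i \<in> S then snd R / 2 else 0) + snd R / 2" for i
    using x by (auto simp: half_cube_def child_cube_def)
  have "fst R $ i \<le> x $ i \<and> x $ i < fst R $ i + snd R" for i
    using i[of i] assms by (auto split: if_splits)
  then show "x \<in> half_cube R" by (simp add: half_cube_def)
  have "i \<in> S \<longleftrightarrow> i \<in> upper_half R x" for i
    using i[of i] assms by (auto simp: upper_half_def split: if_splits)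
  then show "S = upper_half R x" by blast
next
  assume x: "x \<in> half_cube R \<and> S = upper_half R x"
  have "fst R $ i + (if i \<in> S then snd R / 2 else 0) \<le> x $ i \<and>
    x $ i < fst R $ i + (if i \<in> S then snd R / 2 else 0) + snd R / 2" for i
  proof -
    have "fst R $ i \<le> x $ i" "x $ i < fst R $ i + snd R"
      using x by (auto simp: half_cube_def)
    then show ?thesis
      using x by (auto simp: upper_half_def)
  qed
  then show "x \<in> half_cube (child_cube R S)" by (simp add: half_cube_def child_cube_def)
qed

lemma sets_half_cube [measurable, simp]:
  fixes R :: "(real ^ 'n) \<times> real"
  shows "half_cube R \<in> sets borel" "half_cube R \<in> sets lebesgue"
proof -
  have "half_cube R = (\<Inter>i. {x. fst R $ i \<le> x $ i} \<inter> {x. x $ i < fst R $ i + snd R})"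
    by (auto simp: half_cube_def)
  also have "\<dots> \<in> sets borel"
    by (intro sets.finite_INT sets.Int borel_closed borel_open closed_halfspace_component_ge_cart
        open_halfspace_component_lt_cart) auto
  finally show "half_cube R \<in> sets borel" .
  then show "half_cube R \<in> sets lebesgue" by simp
qed

lemma measurable_upper_half: "upper_half R \<in> lebesgue \<rightarrow>\<^sub>M count_space UNIV"
  for R :: "(real ^ 'n) \<times> real"
proof -
  have "upper_half R -` {S} \<inter> space lebesgue \<in> sets lebesgue" for S
  proof -
    have "upper_half R -` {S} =
      (\<Inter>i. if i \<in> S then {x. fst R $ i + snd R / 2 \<le> x $ i} else {x. x $ i < fst R $ i + snd R / 2})"
    proof (rule set_eqI)
      fix x
      show "x \<in> upper_half R -` {S} \<longleftrightarrow> x \<in> (\<Inter>i. if i \<in> S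
          then {x. fst R $ i + snd R / 2 \<le> x $ i} else {x. x $ i < fst R $ i + snd R / 2})"
        unfolding vimage_singleton_eq upper_half_def set_eq_iff mem_Collect_eq INT_iff
        by (auto split: if_splits) (metis not_le)
    qed
    also have "\<dots> \<in> sets borel"
      by (intro sets.finite_INT) (auto intro!: borel_closed borel_open closed_halfspace_component_ge_cart
        open_halfspace_component_lt_cart)
    finally show ?thesis by simp
  qed
  then show ?thesis by (subst measurable_count_space_eq2) auto
qed

lemma AE_half_cube:
  assumes "0 < snd R"
  shows "AE x in lebesgue. x \<in> closed_cube R \<longrightarrow> x \<in> half_cube R"
proof -
  let ?b = "\<chi> i. fst R $ i + snd R"
  have "negligible (cbox (fst R) ?b - box (fst R) ?b)"
    by (rule negligible_frontier_interval)
  then have "AE x in lebesgue. x \<notin> cbox (fst R) ?b - box (fst R) ?b"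
    using AE_not_in by (auto simp only: negligible_iff_null_sets)
  then show ?thesis
    by eventually_elim (auto simp: cube_def half_cube_def mem_box_cart less_imp_le)
qed

lemma nn_integral_half_cube_children:
  fixes R :: "(real ^ 'n) \<times> real"
  assumes "0 < snd R" and \<phi>: "\<phi> \<in> borel_measurable lebesgue"
  shows "(\<Sum>S\<in>UNIV. \<integral>\<^sup>+x\<in>half_cube (child_cube R S). \<phi> x \<partial>lebesgue)
    = (\<integral>\<^sup>+x\<in>half_cube R. \<phi> x \<partial>lebesgue)"
proof -
  have "(\<Sum>S\<in>UNIV. \<integral>\<^sup>+x\<in>half_cube (child_cube R S). \<phi> x \<partial>lebesgue)
    = (\<integral>\<^sup>+x. (\<Sum>S\<in>UNIV. \<phi> x * indicator (half_cube (child_cube R S)) x) \<partial>lebesgue)"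
    by (intro nn_integral_sum[symmetric] borel_measurable_times_ennreal \<phi> borel_measurable_indicator
        sets_half_cube)
  also have "\<dots> = (\<integral>\<^sup>+x\<in>half_cube R. \<phi> x \<partial>lebesgue)"
  proof (intro nn_integral_cong)
    fix x
    have "(\<Sum>S\<in>UNIV. \<phi> x * indicator (half_cube (child_cube R S)) x)
        = (\<Sum>S\<in>UNIV. if S = upper_half R x then \<phi> x * indicator (half_cube R) x else 0)"
      using mem_half_cube_child[OF assms(1), of x]
      by (intro sum.cong) (auto split: split_indicator)
    then show "(\<Sum>S\<in>UNIV. \<phi> x * indicator (half_cube (child_cube R S)) x) = \<phi> x * indicator (half_cube R) x"
      by simp
  qed
  finally show ?thesis .
qed

lemma emeasure_half_cube:
  fixes R :: "(real ^ 'n) \<times> real"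
  assumes "0 < snd R"
  shows "emeasure lborel (half_cube R) = ennreal (snd R ^ CARD('n))"
    and "emeasure lebesgue (half_cube R) = ennreal (snd R ^ CARD('n))"
proof -
  have "emeasure lebesgue (half_cube R) = emeasure lebesgue (closed_cube R)"
    using AE_half_cube[OF assms] half_cube_subset[of R]
    by (intro emeasure_eq_AE) auto
  then show "emeasure lborel (half_cube R) = ennreal (snd R ^ CARD('n))"
    and "emeasure lebesgue (half_cube R) = ennreal (snd R ^ CARD('n))"
    using assms by (simp_all add: emeasure_cube)
qed

subsection \<open>The reverse Holder inequality\<close>

text \<open>Constant of the near part times the cost of returning from the threefold dilate, plus
  the constant of the far part.\<close>

definition mass_const :: "'n::finite itself \<Rightarrow> real \<Rightarrow> real" where
  "mass_const _ p = near_const TYPE('n) p * (15 ^ CARD('n)) powr p + (3 ^ CARD('n)) powr p"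

locale Cp_weight =
  fixes p :: real and w :: "real ^ 'n \<Rightarrow> real"
  assumes p: "1 < p" and w: "weight w"
begin

abbreviation tail :: "(real ^ 'n) \<times> real \<Rightarrow> ennreal" where
  "tail R \<equiv> Cp_tail p w (closed_cube R)"

text \<open>Finiteness of the tail makes the real-valued \<open>tail_avg\<close> meaningful. Cubes
  with infinite tail are treated separately at the end.\<close>

definition node :: "(real ^ 'n) \<times> real \<Rightarrow> bool" where
  "node R \<longleftrightarrow> 0 < snd R \<and> tail R < \<infinity>"

definition tail_avg :: "(real ^ 'n) \<times> real \<Rightarrow> real" where
  "tail_avg R = enn2real (tail R) / snd R ^ CARD('n)"

definition mass :: "(real ^ 'n) \<times> real \<Rightarrow> real" where
  "mass R = enn2real (wmeasure w (half_cube R))"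

lemma tail_child_le: "0 < snd R \<Longrightarrow> tail (child_cube R S) \<le> tail R"
  using p by (intro Cp_tail_mono child_cube_subset) auto

lemma tail_avg_nonneg: "0 < snd R \<Longrightarrow> 0 \<le> tail_avg R"
  by (simp add: tail_avg_def)

lemma ennreal_tail_avg: "node R \<Longrightarrow> ennreal (tail_avg R * snd R ^ CARD('n)) = tail R"
  by (simp add: tail_avg_def node_def)

lemma ennreal_tail_avg': "node R \<Longrightarrow> ennreal (tail_avg R) = tail R / ennreal (snd R ^ CARD('n))"
  using divide_ennreal[of "enn2real (tail R)" "snd R ^ CARD('n)"]
  by (simp add: tail_avg_def node_def)

lemma tail_avg_child_le:
  assumes "node R"
  shows "tail_avg (child_cube R S) \<le> 2 ^ CARD('n) * tail_avg R"
proof -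
  have R: "0 < snd R" "tail R < \<infinity>" using assms by (auto simp: node_def)
  have "enn2real (tail (child_cube R S)) \<le> enn2real (tail R)"
    using R tail_child_le[of R S] by (intro enn2real_mono) auto
  then show ?thesis
    using R by (simp add: tail_avg_def power_divide field_simps)
qed

lemma sum_child_volume:
  "(\<Sum>S\<in>UNIV. snd (child_cube R S) ^ CARD('n)) = snd R ^ CARD('n)" for R :: "(real ^ 'n) \<times> real"
proof -
  have "card (UNIV :: 'n set set) = 2 ^ CARD('n)"
    using card_Pow[of "UNIV :: 'n set"] by simp
  then show ?thesis by (simp add: power_divide)
qed

sublocale stopping_tree node child_cube "\<lambda>R. snd R ^ CARD('n)" tail_avg "2 ^ CARD('n)"
proof
  fix R :: "(real ^ 'n) \<times> real" and S :: "'n set"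
  assume "node R"
  then show "node (child_cube R S)"
    using tail_child_le[of R S] by (auto simp: node_def intro: le_less_trans)
next
  show "(\<Sum>S\<in>UNIV. snd (child_cube R S) ^ CARD('n)) = snd R ^ CARD('n)" for R :: "(real ^ 'n) \<times> real"
    by (rule sum_child_volume)
qed (simp_all add: node_def tail_avg_nonneg tail_avg_child_le[unfolded node_def])

lemma wmeasure_half_cube:
  assumes "node R"
  shows "wmeasure w (half_cube R) \<le> tail R" "ennreal (mass R) = wmeasure w (half_cube R)"
proof -
  have R: "0 < snd R" "tail R < \<infinity>" using assms by (auto simp: node_def)
  have "wmeasure w (half_cube R) \<le> wmeasure w (closed_cube R)"
    unfolding wmeasure_def using half_cube_subset[of R]
    by (intro nn_integral_mono) (auto split: split_indicator)
  also have "\<dots> \<le> tail R"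
    using wmeasure_le_Cp_tail[OF w _ R(1) R(1) order_refl, of p "fst R"] p R by simp
  finally show *: "wmeasure w (half_cube R) \<le> tail R" .
  with R have "wmeasure w (half_cube R) < \<infinity>" by auto
  then show "ennreal (mass R) = wmeasure w (half_cube R)" by (simp add: mass_def)
qed

lemma borel_measurable_w [measurable]: "w \<in> borel_measurable lebesgue"
  by (rule borel_measurable_weight[OF w])

lemma sum_child_mass:
  assumes "node R"
  shows "(\<Sum>S\<in>UNIV. mass (child_cube R S)) = mass R"
proof -
  have "ennreal (\<Sum>S\<in>UNIV. mass (child_cube R S)) = (\<Sum>S\<in>UNIV. wmeasure w (half_cube (child_cube R S)))"
    using assms wmeasure_half_cube(2)[OF node_child[OF assms]]
    by (subst sum_ennreal[symmetric]) (auto simp: mass_def)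
  also have "\<dots> = wmeasure w (half_cube R)"
    unfolding wmeasure_def using assms
    by (intro nn_integral_half_cube_children) (auto simp: node_def)
  also have "\<dots> = ennreal (mass R)" by (rule wmeasure_half_cube(2)[OF assms, symmetric])
  finally show ?thesis
    by (subst (asm) ennreal_inj) (auto simp: mass_def intro: sum_nonneg)
qed

lemma mass_le:
  assumes "node R"
  shows "mass R \<le> tail_avg R * snd R ^ CARD('n)"
proof -
  have "ennreal (mass R) \<le> ennreal (tail_avg R * snd R ^ CARD('n))"
    using wmeasure_half_cube[OF assms] ennreal_tail_avg[OF assms] by simp
  then show ?thesis
    using assms tail_avg_nonneg[of R] by (subst (asm) ennreal_le_iff) (auto simp: node_def)
qed

section \<open>The integral of the dyadic maximal function of the tail averages\<close>

text \<open>At a point \<open>x\<close> the running maximum consists of the start value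
  \<open>f\<close> and of tail averages of subcubes containing \<open>x\<close>, all of which are at
  most \<open>h x\<close>. The tree sum is therefore the integral of a step function below
  \<open>h\<close>.\<close>

lemma tree_sum_le_nn_integral:
  assumes h: "h \<in> borel_measurable lebesgue"
    and avg: "\<And>R x. node R \<Longrightarrow> closed_cube R \<subseteq> Q \<Longrightarrow> x \<in> closed_cube R \<Longrightarrow> ennreal (tail_avg R) \<le> h x"
    and R: "node R" "closed_cube R \<subseteq> Q" "0 \<le> f" "\<And>x. x \<in> half_cube R \<Longrightarrow> ennreal f \<le> h x"
  shows "ennreal (tree_sum k (\<lambda>R f. f * snd R ^ CARD('n)) R f) \<le> (\<integral>\<^sup>+x\<in>half_cube R. h x \<partial>lebesgue)"
  using R
proof (induction k arbitrary: R f)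
  case 0
  have R: "0 < snd R" using 0 by (simp add: node_def)
  have "ennreal (f * snd R ^ CARD('n)) = (\<integral>\<^sup>+x\<in>half_cube R. ennreal f \<partial>lebesgue)"
    using 0 R by (simp add: nn_integral_cmult_indicator emeasure_half_cube ennreal_mult)
  also have "\<dots> \<le> (\<integral>\<^sup>+x\<in>half_cube R. h x \<partial>lebesgue)"
    using 0 by (intro nn_integral_mono) (auto split: split_indicator)
  finally show ?case by simp
next
  case (Suc k)
  have R: "0 < snd R" using Suc by (simp add: node_def)
  let ?f = "\<lambda>S. max f (tail_avg (child_cube R S))"
  have "ennreal (tree_sum (Suc k) (\<lambda>R f. f * snd R ^ CARD('n)) R f)
     = (\<Sum>S\<in>UNIV. ennreal (tree_sum k (\<lambda>R f. f * snd R ^ CARD('n)) (child_cube R S) (?f S)))"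
    using Suc.prems
    by (subst sum_ennreal) (auto intro!: tree_sum_nonneg node_child simp: node_def)
  also have "\<dots> \<le> (\<Sum>S\<in>UNIV. \<integral>\<^sup>+x\<in>half_cube (child_cube R S). h x \<partial>lebesgue)"
  proof (intro sum_mono Suc.IH node_child Suc.prems)
    fix S x
    show sub: "closed_cube (child_cube R S) \<subseteq> Q"
      using child_cube_subset[OF R, of S] Suc.prems by blast
    show "ennreal (?f S) \<le> h x" if x: "x \<in> half_cube (child_cube R S)"
    proof -
      have "ennreal f \<le> h x"
        using x mem_half_cube_child[OF R] Suc.prems(4) by blast
      moreover have "ennreal (tail_avg (child_cube R S)) \<le> h x"
        using x half_cube_subset[of "child_cube R S"] by (intro avg node_child Suc.prems sub) auto
      ultimately show ?thesis by (simp add: max_def)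
    qed
  qed (use Suc.prems in auto)
  also have "\<dots> = (\<integral>\<^sup>+x\<in>half_cube R. h x \<partial>lebesgue)"
    by (rule nn_integral_half_cube_children[OF R h])
  finally show ?case .
qed

lemma nn_integral_HL_maximal_le:
  assumes "0 < l" "Cp_tail p w (cube a l) < \<infinity>" "Cp_const p w < \<infinity>"
  shows "(\<integral>\<^sup>+x\<in>cube a l. HL_maximal (\<lambda>y. indicator (cube a l) y * w y) x \<partial>lebesgue)
    \<le> Cp_const p w * Cp_tail p w (cube a l)" (is "?I \<le> _ * ?t")
proof -
  have le: "?I / ?t \<le> Cp_const p w"
    unfolding Cp_const_def
    by (rule SUP_upper2[OF cube_in_cubes[OF assms(1), of a]]) (use assms(2) in auto)
  show ?thesis
  proof (cases "?t = 0")
    \<comment> \<open>A nonzero quantity divided by 0 is infinite, so a finite constant forces the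
      numerator to vanish.\<close>
    case True
    then have "?I = 0"
      using le assms(3) by (cases "?I = 0") (auto simp: ennreal_divide_zero top_unique)
    then show ?thesis by simp
  next
    case False
    have "?I = ?I / ?t * ?t"
      using False assms(2) ennreal_mult_divide_eq[of ?t ?I]
      by (simp add: ennreal_divide_times ennreal_times_divide mult.commute)
    also have "\<dots> \<le> Cp_const p w * ?t"
      by (intro mult_right_mono le) simp
    finally show ?thesis .
  qed
qed



text \<open>This provides the \<open>mass\<close> hypothesis of the stopping argument, with one
  constant for all nodes and all depths. The C_p constant is applied once, to the threefold dilate
  \<open>N\<close> of the cube.\<close>

lemma tree_sum_tail_avg_le:
  assumes fin: "Cp_const p w < \<infinity>" and R: "node R"
  shows "tree_sum k (\<lambda>R f. f * snd R ^ CARD('n)) R (tail_avg R)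
    \<le> mass_const TYPE('n) p * max (enn2real (Cp_const p w)) 1 * (tail_avg R * snd R ^ CARD('n))"
proof -
  define a l where "a = fst R" and "l = snd R"
  have l: "0 < l" and t: "Cp_tail p w (cube a l) < \<infinity>" using R by (auto simp: node_def a_def l_def)
  define N where "N = cube (a - vec l) (3 * l)"
  define C1 C2 C3 :: real where
    "C1 = near_const TYPE('n) p" and "C2 = (15 ^ CARD('n)) powr p" and "C3 = (3 ^ CARD('n)) powr p"
  have C: "0 \<le> C1" "0 \<le> C2" "0 \<le> C3"
    using near_const_nonneg[OF p, where 'n='n] by (auto simp: C1_def C2_def C3_def)
  \<comment> \<open>By \<open>Cp_tail_subcube_le\<close>, \<open>h\<close> dominates at each point
    the tail averages of all subcubes of \<open>R\<close> containing that point.\<close>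
  define h where "h x = ennreal C1 * HL_maximal (\<lambda>y. indicator N y * w y) x + ennreal C3 * ennreal (tail_avg R)" for x
  have h: "h \<in> borel_measurable lebesgue"
    unfolding h_def by (intro borel_measurable_add borel_measurable_times_ennreal borel_measurable_const
        borel_measurable_HL_maximal)
  have avg: "ennreal (tail_avg R') \<le> h x"
    if R': "node R'" "closed_cube R' \<subseteq> cube a l" "x \<in> closed_cube R'" for R' x
  proof -
    have "tail R' \<le> ennreal (snd R' ^ CARD('n)) * h x"
      unfolding h_def N_def C1_def C3_def ennreal_tail_avg'[OF R]
      using R' by (auto simp: node_def a_def l_def intro!: Cp_tail_subcube_le w p l[unfolded l_def])
    then have "tail R' / ennreal (snd R' ^ CARD('n)) \<le> h x"
      using R' by (intro divide_le_posI_ennreal) (auto simp: node_def mult.commute)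
    then show ?thesis by (simp add: ennreal_tail_avg'[OF R'(1)])
  qed
  have t3: "Cp_tail p w N \<le> ennreal C2 * Cp_tail p w (cube a l)"
    unfolding N_def C2_def using p l by (intro Cp_tail_dilate w) auto
  then have t3fin: "Cp_tail p w N < \<infinity>"
    using t by (auto simp: ennreal_mult_less_top intro: le_less_trans)
  have sub: "half_cube R \<subseteq> N"
  proof
    fix x assume "x \<in> half_cube R"
    then have "x \<in> cube a l" using half_cube_subset[of R] by (auto simp: a_def l_def)
    then show "x \<in> N" using l unfolding N_def mem_cube_minus_vec unfolding mem_cube by (smt (verit))
  qed
  have "ennreal (tree_sum k (\<lambda>R f. f * snd R ^ CARD('n)) R (tail_avg R))
      \<le> (\<integral>\<^sup>+x\<in>half_cube R. h x \<partial>lebesgue)"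
    using half_cube_subset[of R] l
    by (intro tree_sum_le_nn_integral[OF h avg, where Q="cube a l"] R)
      (auto simp: a_def l_def tail_avg_nonneg intro!: avg R)
  also have "\<dots> = (\<integral>\<^sup>+x. ennreal C1 * (HL_maximal (\<lambda>y. indicator N y * w y) x * indicator (half_cube R) x)
      + ennreal C3 * ennreal (tail_avg R) * indicator (half_cube R) x \<partial>lebesgue)"
    by (intro nn_integral_cong) (simp add: h_def distrib_right mult.assoc)
  also have "\<dots> = ennreal C1 * (\<integral>\<^sup>+x\<in>half_cube R. HL_maximal (\<lambda>y. indicator N y * w y) x \<partial>lebesgue)
      + ennreal C3 * ennreal (tail_avg R) * ennreal (l ^ CARD('n))"
    using l by (subst nn_integral_add)
      (auto intro!: borel_measurable_times_ennreal borel_measurable_HL_maximal nn_integral_cmult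
        simp: nn_integral_cmult_indicator emeasure_half_cube l_def)
  also have "\<dots> \<le> ennreal C1 * (Cp_const p w * (ennreal C2 * tail R)) + ennreal C3 * tail R"
  proof (intro add_mono mult_left_mono)
    have "(\<integral>\<^sup>+x\<in>half_cube R. HL_maximal (\<lambda>y. indicator N y * w y) x \<partial>lebesgue)
       \<le> (\<integral>\<^sup>+x\<in>N. HL_maximal (\<lambda>y. indicator N y * w y) x \<partial>lebesgue)"
      using sub by (intro nn_integral_mono) (auto split: split_indicator)
    also have "\<dots> \<le> Cp_const p w * Cp_tail p w N"
      unfolding N_def using t3fin l fin by (intro nn_integral_HL_maximal_le) (auto simp: N_def)
    also have "\<dots> \<le> Cp_const p w * (ennreal C2 * tail R)"
      using t3 by (intro mult_left_mono) (auto simp: a_def l_def)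
    finally show "(\<integral>\<^sup>+x\<in>half_cube R. HL_maximal (\<lambda>y. indicator N y * w y) x \<partial>lebesgue)
      \<le> Cp_const p w * (ennreal C2 * tail R)" .
    show "ennreal C3 * ennreal (tail_avg R) * ennreal (l ^ CARD('n)) \<le> ennreal C3 * tail R"
      using l tail_avg_nonneg[of R] ennreal_tail_avg[OF R]
      by (simp add: mult.assoc ennreal_mult[symmetric] l_def)
  qed auto
  also have "\<dots> = ennreal ((C1 * enn2real (Cp_const p w) * C2 + C3) * (tail_avg R * snd R ^ CARD('n)))"
  proof -
    obtain c where c: "0 \<le> c" "Cp_const p w = ennreal c"
      using fin by (cases "Cp_const p w") auto
    show ?thesis
      using C c l tail_avg_nonneg[of R] unfolding ennreal_tail_avg[OF R, symmetric]
      by (simp add: l_def ennreal_mult[symmetric] ennreal_plus[symmetric] algebra_simps del: ennreal_plus)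
  qed
  also have "\<dots> \<le> ennreal (mass_const TYPE('n) p * max (enn2real (Cp_const p w)) 1 * (tail_avg R * snd R ^ CARD('n)))"
  proof (intro ennreal_leI mult_right_mono)
    let ?m = "max (enn2real (Cp_const p w)) 1"
    \<comment> \<open>The far part carries no factor [w]; the maximum with 1 lets both parts share
      one factor.\<close>
    have "C1 * enn2real (Cp_const p w) * C2 + C3 * 1 \<le> C1 * ?m * C2 + C3 * ?m"
      using C by (intro add_mono mult_right_mono mult_left_mono) auto
    then show "C1 * enn2real (Cp_const p w) * C2 + C3 \<le> mass_const TYPE('n) p * ?m"
      by (simp add: mass_const_def C1_def C2_def C3_def algebra_simps)
  qed (use l tail_avg_nonneg[of R] in \<open>auto simp: l_def\<close>)
  finally show ?thesis
    using C l tail_avg_nonneg[of R]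
    by (subst (asm) ennreal_le_iff) (auto simp: l_def mass_const_def C1_def C2_def C3_def)
qed

section \<open>The truncated dyadic maximal function and its comparison with the weight\<close>

text \<open>For \<open>x\<close> in \<open>half_cube R\<close>, the largest of \<open>f\<close> and
  the tail averages of the dyadic cubes of generations 1 to \<open>k\<close> that contain
  \<open>x\<close>. Started at \<open>tail_avg R\<close>, it also covers generation 0.\<close>

primrec run_max :: "nat \<Rightarrow> (real ^ 'n) \<times> real \<Rightarrow> real \<Rightarrow> real ^ 'n \<Rightarrow> real" where
  "run_max 0 R f x = f"
| "run_max (Suc k) R f x =
     run_max k (child_cube R (upper_half R x)) (max f (tail_avg (child_cube R (upper_half R x)))) x"

lemma borel_measurable_run_max: "run_max k R f \<in> borel_measurable lebesgue"
proof (induction k arbitrary: R f)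
  case 0
  have "run_max 0 R f = (\<lambda>_. f)" by auto
  then show ?case by simp
next
  case (Suc k)
  have "(\<lambda>x. run_max k (child_cube R (upper_half R x))
          (max f (tail_avg (child_cube R (upper_half R x)))) x) \<in> borel_measurable lebesgue"
    by (rule measurable_compose_countable'[where I=UNIV and g="upper_half R"])
      (auto intro: Suc measurable_upper_half)
  then show ?case by simp
qed

lemma run_max_ge: "f \<le> run_max k R f x"
proof (induction k arbitrary: R f)
  case (Suc k)
  show ?case
    using Suc[of "max f (tail_avg (child_cube R (upper_half R x)))"] by (auto intro: order_trans)
qed simp

text \<open>The cube of generation \<open>k\<close> around \<open>x\<close> is itself one of the
  cubes in the maximum, and its side tends to 0 with \<open>k\<close>, as differentiation requires.
  The assumption on \<open>f\<close> is the case \<open>k = 0\<close>.\<close>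

lemma run_max_descendant:
  assumes "node R" "x \<in> half_cube R" "tail_avg R \<le> f"
  obtains R' where "node R'" "x \<in> half_cube R'" "snd R' = snd R / 2 ^ k" "tail_avg R' \<le> run_max k R f x"
  using assms
proof (induction k arbitrary: R f thesis)
  case 0
  then show ?case by (metis run_max.simps(1) power_0 div_by_1)
next
  case (Suc k)
  let ?R = "child_cube R (upper_half R x)"
  have R: "0 < snd R" using Suc.prems by (simp add: node_def)
  show ?case
  proof (rule Suc.IH[of ?R "max f (tail_avg ?R)"])
    show "node ?R" by (rule node_child[OF Suc.prems(2)])
    show "x \<in> half_cube ?R"
      using Suc.prems(3) by (simp add: mem_half_cube_child[OF R])
    fix R' assume R': "node R'" "x \<in> half_cube R'" "snd R' = snd ?R / 2 ^ k"
      "tail_avg R' \<le> run_max k ?R (max f (tail_avg ?R)) x"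
    show thesis
      by (rule Suc.prems(1)[of R']) (use R' in auto)
  qed simp
qed

text \<open>On each half-open child the index \<open>upper_half R\<close> is constant, so splitting
  the integral over the children reproduces the recursion of \<open>tree_sum\<close>.\<close>

lemma nn_integral_run_max:
  assumes "node R" "0 \<le> f"
  shows "(\<integral>\<^sup>+x\<in>half_cube R. ennreal (run_max k R f x powr e * w x) \<partial>lebesgue)
    \<le> ennreal (tree_sum k (\<lambda>R f. f powr e * mass R) R f)"
  using assms
proof (induction k arbitrary: R f)
  case 0
  have "(\<integral>\<^sup>+x\<in>half_cube R. ennreal (run_max 0 R f x powr e * w x) \<partial>lebesgue)
     = ennreal (f powr e) * wmeasure w (half_cube R)"
    unfolding wmeasure_def
  proof (subst nn_integral_cmult[symmetric])
    show "(\<lambda>x. ennreal (w x) * indicator (half_cube R) x) \<in> borel_measurable lebesgue"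
      by (intro borel_measurable_times_ennreal measurable_compose[OF _ measurable_ennreal]
          borel_measurable_w borel_measurable_indicator sets_half_cube)
    show "(\<integral>\<^sup>+x\<in>half_cube R. ennreal (run_max 0 R f x powr e * w x) \<partial>lebesgue)
      = (\<integral>\<^sup>+x. ennreal (f powr e) * (ennreal (w x) * indicator (half_cube R) x) \<partial>lebesgue)"
      by (intro nn_integral_cong) (simp add: ennreal_mult weight_nonneg[OF w] mult.assoc)
  qed
  also have "\<dots> = ennreal (f powr e * mass R)"
  proof -
    have "0 \<le> mass R" by (simp add: mass_def)
    then show ?thesis
      unfolding wmeasure_half_cube(2)[OF 0(1), symmetric] by (simp add: ennreal_mult)
  qed
  finally show ?case by simp
next
  case (Suc k)
  have R: "0 < snd R" using Suc.prems by (simp add: node_def)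
  let ?f = "\<lambda>S. max f (tail_avg (child_cube R S))"
  have "(\<integral>\<^sup>+x\<in>half_cube R. ennreal (run_max (Suc k) R f x powr e * w x) \<partial>lebesgue)
     = (\<Sum>S\<in>UNIV. \<integral>\<^sup>+x\<in>half_cube (child_cube R S). ennreal (run_max (Suc k) R f x powr e * w x) \<partial>lebesgue)"
    by (intro nn_integral_half_cube_children[symmetric] R measurable_compose[OF _ measurable_ennreal]
        borel_measurable_times powr_real_measurable borel_measurable_run_max borel_measurable_w
        borel_measurable_const)
  also have "\<dots> = (\<Sum>S\<in>UNIV. \<integral>\<^sup>+x\<in>half_cube (child_cube R S).
      ennreal (run_max k (child_cube R S) (?f S) x powr e * w x) \<partial>lebesgue)"
  proof (intro sum.cong nn_integral_cong refl)
    fix S x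
    show "ennreal (run_max (Suc k) R f x powr e * w x) * indicator (half_cube (child_cube R S)) x
      = ennreal (run_max k (child_cube R S) (?f S) x powr e * w x) * indicator (half_cube (child_cube R S)) x"
      using mem_half_cube_child[OF R, of x S] by (auto split: split_indicator)
  qed
  also have "\<dots> \<le> (\<Sum>S\<in>UNIV. ennreal (tree_sum k (\<lambda>R f. f powr e * mass R) (child_cube R S) (?f S)))"
    using Suc.prems by (intro sum_mono Suc.IH node_child) auto
  also have "\<dots> = ennreal (tree_sum (Suc k) (\<lambda>R f. f powr e * mass R) R f)"
    using Suc.prems
    by (subst sum_ennreal) (auto intro!: tree_sum_nonneg node_child simp: mass_def)
  finally show ?case .
qed

text \<open>Passage to the gauge integral, in which the differentiation theorem is phrased.\<close>

lemma wmeasure_cube_eq_integral: "wmeasure w (cube a l) = ennreal (integral (cube a l) w)"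
proof -
  have int: "set_integrable lebesgue (cube a l) w"
    using w by (simp add: weight_def cube_def)
  have "wmeasure w (cube a l) = (\<integral>\<^sup>+x. ennreal (indicator (cube a l) x *\<^sub>R w x) \<partial>lebesgue)"
    unfolding wmeasure_def by (intro nn_integral_cong) (auto split: split_indicator)
  also have "\<dots> = ennreal (LINT x:cube a l|lebesgue. w x)"
    unfolding set_lebesgue_integral_def using int weight_nonneg[OF w]
    by (intro nn_integral_eq_integral) (auto simp: set_integrable_def)
  also have "(LINT x:cube a l|lebesgue. w x) = integral (cube a l) w"
    by (rule set_lebesgue_integral_eq_integral(2)[OF int])
  finally show ?thesis .
qed

text \<open>The differentiation theorem of the library concerns the cubes with corner \<open>x\<close>, which only lie
  in the neighbours of the dyadic cubes containing \<open>x\<close>; the tails see these neighbours.\<close>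

lemma AE_weight_le_run_max:
  assumes R: "node R"
  shows "AE x in lebesgue. x \<in> half_cube R \<longrightarrow>
    eventually (\<lambda>k. w x \<le> 2 * (3 ^ CARD('n)) powr p * run_max k R (tail_avg R) x) sequentially"
proof -
  have "w integrable_on cbox a b" for a b
    using w by (intro set_lebesgue_integral_eq_integral(1)) (simp add: weight_def)
  then obtain N where N: "negligible N"
    and diff: "\<And>x e. x \<notin> N \<Longrightarrow> 0 < e \<Longrightarrow> \<exists>d>0. \<forall>h. 0 < h \<and> h < d \<longrightarrow>
        norm (integral (cbox x (x + h *\<^sub>R One)) w /\<^sub>R h ^ DIM(real ^ 'n) - w x) < e"
    using integrable_ccontinuous_explicit[of w] by blast
  have l0: "0 < snd R" using R by (simp add: node_def)
  have "eventually (\<lambda>k. w x \<le> 2 * (3 ^ CARD('n)) powr p * run_max k R (tail_avg R) x) sequentially"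
    if x: "x \<notin> N" "x \<in> half_cube R" for x
  proof (cases "w x = 0")
    case True
    have "0 \<le> run_max k R (tail_avg R) x" for k
      using run_max_ge[of "tail_avg R" k R x] tail_avg_nonneg[OF l0] by linarith
    with True show ?thesis by simp
  next
    case False
    \<comment> \<open>With the tolerance \<open>w x / 2\<close> the averages over small cubes exceed
      \<open>w x / 2\<close>, which is the origin of the factor 2.\<close>
    then have "0 < w x / 2" using weight_nonneg[OF w, of x] by simp
    from diff[OF x(1) this] obtain d where d: "0 < d" and
      dh: "\<And>h. 0 < h \<Longrightarrow> h < d \<Longrightarrow>
        norm (integral (cbox x (x + h *\<^sub>R One)) w /\<^sub>R h ^ DIM(real ^ 'n) - w x) < w x / 2"
      by blast
    have "(\<lambda>k. snd R / 2 ^ k) \<longlonglongrightarrow> 0"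
      by (rule LIMSEQ_divide_realpow_zero) simp
    then have "eventually (\<lambda>k. snd R / 2 ^ k < d) sequentially"
      using d by (rule order_tendstoD)
    then show ?thesis
    proof eventually_elim
      case (elim k)
      define h where "h = snd R / 2 ^ k"
      have h: "0 < h" "h < d" using elim l0 by (auto simp: h_def)
      obtain R' where R': "node R'" "x \<in> half_cube R'" "snd R' = h"
        "tail_avg R' \<le> run_max k R (tail_avg R) x"
        unfolding h_def using run_max_descendant[OF R x(2) order_refl] by blast
      define a where "a = fst R'"
      have cb: "cbox x (x + h *\<^sub>R One) = cube x h"
      proof -
        have "(One :: real ^ 'n) $ i = 1" for i
          using inner_sum_left_Basis[of "axis i 1" "\<lambda>_. 1"] by (simp add: cart_eq_inner_axis)
        then have "(One :: real ^ 'n) = vec 1"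
          unfolding vec_eq_iff vec_component by blast
        then show ?thesis
          unfolding cube_def by (intro arg_cong[where f="cbox x"]) (simp only: vec_eq_iff, simp)
      qed
      have "w x / 2 < integral (cube x h) w / h ^ CARD('n)"
      proof -
        have "norm (integral (cube x h) w /\<^sub>R h ^ DIM(real ^ 'n) - w x) < w x / 2"
          using dh[OF h] unfolding cb .
        moreover have "integral (cube x h) w /\<^sub>R h ^ DIM(real ^ 'n) = integral (cube x h) w / h ^ CARD('n)"
          by (simp add: divide_inverse_commute)
        ultimately have "\<bar>integral (cube x h) w / h ^ CARD('n) - w x\<bar> < w x / 2"
          unfolding real_norm_def by metis
        then show ?thesis unfolding abs_less_iff by linarith
      qed
      then have "ennreal (w x / 2 * h ^ CARD('n)) \<le> ennreal (integral (cube x h) w)"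
        using h by (intro ennreal_leI) (simp add: field_simps)
      also have "\<dots> = wmeasure w (cube x h)" by (simp add: wmeasure_cube_eq_integral)
      also have "\<dots> \<le> wmeasure w (cube (a - vec h) (3 * h))"
      proof -
        have "x \<in> cube a h" using R' half_cube_subset[of R'] by (auto simp: a_def)
        then have "cube x h \<subseteq> cube (a - vec h) (3 * h)"
          using h unfolding subset_iff mem_cube_minus_vec unfolding mem_cube by (smt (verit))
        then show ?thesis
          unfolding wmeasure_def by (intro nn_integral_mono) (auto split: split_indicator)
      qed
      also have "\<dots> \<le> ennreal (((3 * h / h) ^ CARD('n)) powr p) * Cp_tail p w (cube a h)"
      proof (rule wmeasure_le_Cp_tail[OF w])
        show "cube a h \<subseteq> cube (a - vec h) (3 * h)"
          using h unfolding subset_iff mem_cube_minus_vec unfolding mem_cube by (smt (verit))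
      qed (use p h in auto)
      also have "\<dots> = ennreal ((3 ^ CARD('n)) powr p) * ennreal (tail_avg R' * h ^ CARD('n))"
        using h R' ennreal_tail_avg[OF R'(1)] by (simp add: a_def)
      also have "\<dots> = ennreal ((3 ^ CARD('n)) powr p * (tail_avg R' * h ^ CARD('n)))"
        using h R' tail_avg_nonneg[of R'] by (simp add: ennreal_mult)
      finally have "w x / 2 * h ^ CARD('n) \<le> (3 ^ CARD('n)) powr p * (tail_avg R' * h ^ CARD('n))"
        using h R' tail_avg_nonneg[of R'] by (subst (asm) ennreal_le_iff) auto
      then have "w x / 2 \<le> (3 ^ CARD('n)) powr p * tail_avg R'"
        using h by simp
      also have "\<dots> \<le> (3 ^ CARD('n)) powr p * run_max k R (tail_avg R) x"
        using R' by (intro mult_left_mono) auto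
      finally show "w x \<le> 2 * (3 ^ CARD('n)) powr p * run_max k R (tail_avg R) x" by simp
    qed
  qed
  moreover have "AE x in lebesgue. x \<notin> N"
    using N AE_not_in by (auto simp only: negligible_iff_null_sets)
  ultimately show ?thesis by (auto elim!: eventually_mono)
qed

text \<open>Write w^(1+e) as w^e times w and replace the first factor by a multiple of the truncated
  maximal function. The comparison holds only from some generation on that depends on the point,
  hence the lower limit and Fatou's lemma; the integrals are bounded uniformly in the generation.
  The 4 is the 2 of the stopping argument times the bound \<open>e2\<close>.\<close>

lemma reverse_Holder_half_cube:
  assumes fin: "Cp_const p w < \<infinity>" and R: "node R" and e: "0 < e"
    and e1: "2 * (2 ^ CARD('n) * (mass_const TYPE('n) p * max (enn2real (Cp_const p w)) 1) * e) \<le> 1"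
    and e2: "(2 * (3 ^ CARD('n)) powr p) powr e \<le> 2"
  shows "(\<integral>\<^sup>+x\<in>closed_cube R. ennreal (w x powr (1 + e)) \<partial>lebesgue)
    \<le> ennreal (4 * (tail_avg R powr (1 + e) * snd R ^ CARD('n)))"
proof -
  define C where "C = 2 * (3 ^ CARD('n)) powr p"
  define V where "V = tail_avg R powr (1 + e) * snd R ^ CARD('n)"
  define \<psi> where "\<psi> k x = ennreal (run_max k R (tail_avg R) x powr e * w x) * indicator (half_cube R) x" for k x
  define \<phi> where "\<phi> k x = ennreal (C powr e) * \<psi> k x" for k x
  have l: "0 < snd R" using R by (simp add: node_def)
  have V: "0 \<le> V" using l by (simp add: V_def)
  have K: "0 < mass_const TYPE('n) p * max (enn2real (Cp_const p w)) 1"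
    using near_const_nonneg[OF p, where 'n='n]
    by (intro mult_pos_pos) (auto simp: mass_const_def intro!: add_nonneg_pos)
  have \<psi>: "\<psi> k \<in> borel_measurable lebesgue" for k
    unfolding \<psi>_def
    by (intro borel_measurable_times_ennreal measurable_compose[OF _ measurable_ennreal]
        borel_measurable_times powr_real_measurable borel_measurable_run_max borel_measurable_w
        borel_measurable_const borel_measurable_indicator sets_half_cube)
  have \<phi>: "\<phi> k \<in> borel_measurable lebesgue" for k
    unfolding \<phi>_def by (intro borel_measurable_times_ennreal borel_measurable_const \<psi>)
  have \<phi>_le: "(\<integral>\<^sup>+x. \<phi> k x \<partial>lebesgue) \<le> ennreal (4 * V)" for k
  proof -
    have "(\<integral>\<^sup>+x. \<psi> k x \<partial>lebesgue) \<le> ennreal (tree_sum k (\<lambda>R f. f powr e * mass R) R (tail_avg R))"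
      unfolding \<psi>_def by (intro nn_integral_run_max R tail_avg_nonneg l)
    also have "\<dots> \<le> ennreal (2 * V)"
      unfolding V_def
      by (intro ennreal_leI tree_sum_reverse_Holder[OF e e1 K])
        (auto intro: tree_sum_tail_avg_le fin sum_child_mass mass_le R)
    finally have "(\<integral>\<^sup>+x. \<psi> k x \<partial>lebesgue) \<le> ennreal (2 * V)" .
    then have "ennreal (C powr e) * (\<integral>\<^sup>+x. \<psi> k x \<partial>lebesgue) \<le> ennreal 2 * ennreal (2 * V)"
      using e2 unfolding C_def by (intro mult_mono ennreal_leI) auto
    then show ?thesis
      unfolding \<phi>_def nn_integral_cmult[OF \<psi>]
      using V ennreal_mult[of 2 "2 * V"] by simp
  qed
  have ae: "AE x in lebesgue. ennreal (w x powr (1 + e)) * indicator (closed_cube R) x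
    \<le> liminf (\<lambda>k. \<phi> k x)"
    using AE_weight_le_run_max[OF R] AE_half_cube[OF l]
  proof eventually_elim
    case (elim x)
    show ?case
    proof (cases "x \<in> closed_cube R")
      case True
      then have x: "x \<in> half_cube R" using elim by simp
      have w0: "0 \<le> w x" by (rule weight_nonneg[OF w])
      have "eventually (\<lambda>k. w x \<le> C * run_max k R (tail_avg R) x) sequentially"
        using elim x by (simp add: C_def)
      then have "eventually (\<lambda>k. ennreal (w x powr (1 + e)) \<le> \<phi> k x) sequentially"
      proof eventually_elim
        case (elim k)
        have r0: "0 \<le> run_max k R (tail_avg R) x"
          using run_max_ge[of "tail_avg R" k R x] tail_avg_nonneg[OF l] by linarith
        have "w x powr (1 + e) = w x powr e * w x"
          using w0 by (simp add: powr_add)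
        also have "\<dots> \<le> (C * run_max k R (tail_avg R) x) powr e * w x"
          using elim w0 e by (intro mult_right_mono powr_mono2) auto
        also have "\<dots> = C powr e * (run_max k R (tail_avg R) x powr e * w x)"
          using r0 by (simp add: powr_mult C_def)
        finally show ?case
          using x w0 by (simp add: \<phi>_def \<psi>_def ennreal_mult[symmetric] ennreal_leI)
      qed
      then have "ennreal (w x powr (1 + e)) \<le> liminf (\<lambda>k. \<phi> k x)"
        by (rule Liminf_bounded)
      then show ?thesis using True by simp
    qed simp
  qed
  have "(\<integral>\<^sup>+x\<in>closed_cube R. ennreal (w x powr (1 + e)) \<partial>lebesgue)
      \<le> (\<integral>\<^sup>+x. liminf (\<lambda>k. \<phi> k x) \<partial>lebesgue)"
    by (rule nn_integral_mono_AE[OF ae])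
  also have "\<dots> \<le> liminf (\<lambda>k. \<integral>\<^sup>+x. \<phi> k x \<partial>lebesgue)"
    by (rule nn_integral_liminf[OF \<phi>])
  also have "\<dots> \<le> liminf (\<lambda>k::nat. ennreal (4 * V))"
    by (intro Liminf_mono always_eventually allI \<phi>_le)
  also have "\<dots> = ennreal (4 * V)" by (simp add: Liminf_const)
  finally show ?thesis by (simp add: V_def)
qed

section \<open>Consequences: the normalised inequality and membership in the class C_p\<close>

lemma epowr_reverse_Holder:
  assumes R: "node R" and e: "0 < e"
    and X: "X \<le> ennreal (4 * (tail_avg R powr (1 + e) * snd R ^ CARD('n)))"
  shows "epowr (X / emeasure lebesgue (closed_cube R)) (1 / (1 + e))
    \<le> 4 / emeasure lebesgue (closed_cube R) * tail R"
proof -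
  define A v where "A = tail_avg R" and "v = snd R ^ CARD('n)"
  have l: "0 < snd R" using R by (simp add: node_def)
  have A: "0 \<le> A" and v: "0 < v"
    using l tail_avg_nonneg[OF l] by (auto simp: A_def v_def)
  have em: "emeasure lebesgue (closed_cube R) = ennreal v"
    using l by (simp add: emeasure_cube v_def)
  have t: "tail R = ennreal (A * v)"
    using ennreal_tail_avg[OF R] by (simp add: A_def v_def)
  have "X / ennreal v \<le> ennreal (4 * A powr (1 + e))"
  proof (rule divide_le_posI_ennreal)
    show "0 < ennreal v" using v by simp
    show "X \<le> ennreal v * ennreal (4 * A powr (1 + e))"
      using X v A by (simp add: ennreal_mult[symmetric] mult_ac A_def v_def)
  qed
  then have "epowr (X / ennreal v) (1 / (1 + e)) \<le> epowr (ennreal (4 * A powr (1 + e))) (1 / (1 + e))"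
    using e by (intro epowr_mono) auto
  also have "\<dots> = ennreal ((4 * A powr (1 + e)) powr (1 / (1 + e)))"
    by (simp add: epowr_ennreal)
  also have "(4 * A powr (1 + e)) powr (1 / (1 + e)) = 4 powr (1 / (1 + e)) * A"
    using e A by (simp add: powr_mult powr_powr)
  \<comment> \<open>The root is taken of the constant as well, and a root of 4 of order
    \<open>1 + e\<close> is at most 4.\<close>
  also have "ennreal \<dots> \<le> ennreal (4 powr 1 * A)"
    using e A by (intro ennreal_leI mult_right_mono powr_mono) auto
  also have "\<dots> = 4 / ennreal v * ennreal (A * v)"
  proof -
    have "4 / ennreal v = ennreal (4 / v)"
      using v divide_ennreal[of 4 v] by simp
    then show ?thesis using v A by (simp add: ennreal_mult[symmetric])
  qed
  finally show ?thesis by (simp add: em t)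
qed

text \<open>Splitting \<open>w\<close> at the level \<open>A (|Q| / |E|)\<^sup>1\<^sup>/\<^sup>(\<^sup>1\<^sup>+\<^sup>e\<^sup>)\<close>, where \<open>A\<close> is the average of the tail,
  balances the two contributions to \<open>w(E)\<close>.\<close>

lemma wmeasure_le_powr_tail:
  assumes R: "node R" and e: "0 < e"
    and X: "(\<integral>\<^sup>+x\<in>closed_cube R. ennreal (w x powr (1 + e)) \<partial>lebesgue)
      \<le> ennreal (4 * (tail_avg R powr (1 + e) * snd R ^ CARD('n)))"
    and E: "E \<in> sets lebesgue" "E \<subseteq> closed_cube R"
  shows "wmeasure w E
    \<le> ennreal (5 * (measure lebesgue E / measure lebesgue (closed_cube R)) powr (e / (1 + e))) * tail R"
proof -
  define A v m where "A = tail_avg R" and "v = snd R ^ CARD('n)" and "m = measure lebesgue E"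
  have l: "0 < snd R" using R by (simp add: node_def)
  have A: "0 \<le> A" and v: "0 < v"
    using l tail_avg_nonneg[OF l] by (auto simp: A_def v_def)
  have ev: "emeasure lebesgue (closed_cube R) = ennreal v"
    using l by (simp add: emeasure_cube v_def)
  then have mv: "measure lebesgue (closed_cube R) = v"
    using v by (simp add: measure_def)
  have t: "tail R = ennreal (A * v)"
    using ennreal_tail_avg[OF R] by (simp add: A_def v_def)
  have "emeasure lebesgue E \<le> ennreal v"
    using emeasure_mono[OF E(2), of lebesgue] ev by simp
  then have em: "emeasure lebesgue E = ennreal m"
    unfolding m_def by (intro emeasure_eq_ennreal_measure) (auto simp: top_unique)
  have m0: "0 \<le> m" by (simp add: m_def)
  have wE: "wmeasure w E \<le> tail R"
  proof -
    have "wmeasure w E \<le> wmeasure w (closed_cube R)"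
      unfolding wmeasure_def using E(2) by (intro nn_integral_mono) (auto split: split_indicator)
    also have "\<dots> \<le> tail R"
      using wmeasure_le_Cp_tail[OF w _ l l order_refl, of p "fst R"] p l by simp
    finally show ?thesis .
  qed
  consider "m = 0" | "A = 0" | "0 < m" "0 < A" using m0 A by linarith
  then have "wmeasure w E \<le> ennreal (5 * (m / v) powr (e / (1 + e)) * (A * v))"
  proof cases
    case 1
    then have "E \<in> null_sets lebesgue" using em E by (simp add: null_sets_def)
    then show ?thesis by (simp add: wmeasure_def nn_integral_null_set)
  next
    case 2
    then show ?thesis using wE t by simp
  next
    case 3
    define q where "q = e / (1 + e)"
    \<comment> \<open>Since \<open>q - 1\<close> equals -1 / (1 + e), this is the splitting level;
      the cases \<open>m = 0\<close> and \<open>A = 0\<close>, where it degenerates, have been set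
      aside.\<close>
    define s where "s = A * (m / v) powr (q - 1)"
    have s: "0 < s" using 3 v by (simp add: s_def)
    have q: "(q - 1) * (1 + e) = - 1" using e by (simp add: q_def field_simps)
    have mv1: "(m / v) powr (q - 1) * (m / v) = (m / v) powr q"
      using 3 v by (simp add: powr_diff)
    have sm: "s * m = (m / v) powr q * (A * v)"
      using v mv1 by (simp add: s_def field_simps)
    have se: "s powr - e * (A powr (1 + e) * v) = (m / v) powr q * (A * v)"
    proof -
      have "(m / v) powr ((q - 1) * - e) = (m / v) powr q"
        using q by (intro arg_cong[where f="\<lambda>x. (m / v) powr x"]) (simp add: algebra_simps)
      then have "s powr - e = A powr - e * (m / v) powr q"
        using 3 v by (simp add: s_def powr_mult powr_powr)
      moreover have "A powr - e * A powr (1 + e) = A"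
        using 3 by (simp add: powr_add[symmetric])
      ultimately show ?thesis by (simp add: mult_ac)
    qed
    \<comment> \<open>Above the level \<open>s\<close> the factor (w / s)^e is at least 1 and may be
      inserted for free.\<close>
    have wx: "w x \<le> s + s powr - e * w x powr (1 + e)" for x
    proof (cases "w x \<le> s")
      case False
      then have "s powr e \<le> w x powr e" using s e by (intro powr_mono2) auto
      then have "w x * 1 \<le> w x * (s powr - e * w x powr e)"
        using False s by (intro mult_left_mono) (auto simp: powr_minus field_simps)
      also have "\<dots> = s powr - e * w x powr (1 + e)"
        using False s by (simp add: powr_add)
      finally show ?thesis using s by simp
    qed (use s in \<open>simp add: add_increasing2\<close>)
    have "wmeasure w E \<le> (\<integral>\<^sup>+x. ennreal s * indicator E x
        + ennreal (s powr - e) * (ennreal (w x powr (1 + e)) * indicator (closed_cube R) x) \<partial>lebesgue)"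
      unfolding wmeasure_def
    proof (rule nn_integral_mono)
      fix x
      show "ennreal (w x) * indicator E x \<le> ennreal s * indicator E x
        + ennreal (s powr - e) * (ennreal (w x powr (1 + e)) * indicator (closed_cube R) x)"
      proof (cases "x \<in> E")
        case True
        have "ennreal (w x) \<le> ennreal (s + s powr - e * w x powr (1 + e))"
          by (intro ennreal_leI wx)
        also have "\<dots> = ennreal s + ennreal (s powr - e) * ennreal (w x powr (1 + e))"
          using s by (simp add: ennreal_mult)
        finally show ?thesis using True E(2) by (auto simp: subset_iff)
      qed simp
    qed
    also have "\<dots> = ennreal s * emeasure lebesgue E
        + ennreal (s powr - e) * (\<integral>\<^sup>+x\<in>closed_cube R. ennreal (w x powr (1 + e)) \<partial>lebesgue)"
    proof -
      have m: "(\<lambda>x. ennreal (w x powr (1 + e)) * indicator (closed_cube R) x) \<in> borel_measurable lebesgue"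
        by (intro borel_measurable_times_ennreal measurable_compose[OF _ measurable_ennreal]
            powr_real_measurable borel_measurable_w borel_measurable_const borel_measurable_indicator
            sets_cube)
      show ?thesis
        by (subst nn_integral_add)
          (auto intro!: borel_measurable_times_ennreal borel_measurable_const
            borel_measurable_indicator E m simp: nn_integral_cmult[OF m] nn_integral_cmult_indicator E)
    qed
    also have "\<dots> \<le> ennreal s * ennreal m + ennreal (s powr - e) * ennreal (4 * (A powr (1 + e) * v))"
      using X by (intro add_mono mult_left_mono) (auto simp: em A_def v_def)
    also have "\<dots> = ennreal (s * m + s powr - e * (4 * (A powr (1 + e) * v)))"
      using s m0 v by (simp add: ennreal_mult[symmetric] ennreal_plus[symmetric] del: ennreal_plus)
    \<comment> \<open>The part below the level contributes 1 and the part above it contributes 4,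
      both times the same quantity.\<close>
    also have "s * m + s powr - e * (4 * (A powr (1 + e) * v)) = 5 * (m / v) powr q * (A * v)"
      using sm se by linarith
    finally show ?thesis by (simp add: q_def)
  qed
  then show ?thesis
    unfolding mv t m_def[symmetric] using v A by (simp add: ennreal_mult)
qed

lemma Cp_classI:
  assumes e: "0 < e"
    and X: "\<And>R. node R \<Longrightarrow> (\<integral>\<^sup>+x\<in>closed_cube R. ennreal (w x powr (1 + e)) \<partial>lebesgue)
      \<le> ennreal (4 * (tail_avg R powr (1 + e) * snd R ^ CARD('n)))"
  shows "w \<in> Cp_class p"
proof -
  have "wmeasure w E \<le> ennreal (5 * (measure lebesgue E / measure lebesgue Q) powr (e / (1 + e))) * Cp_tail p w Q"
    if "Q \<in> cubes" and E: "E \<in> sets lebesgue" "E \<subseteq> Q" for Q E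
  proof -
    obtain a l where l: "0 < l" and Q: "Q = cube a l" using \<open>Q \<in> cubes\<close> by (rule cubesE)
    show ?thesis
    proof (cases "Cp_tail p w Q = \<infinity>")
      case False
      then have "node (a, l)" using l Q by (simp add: node_def less_top)
      from wmeasure_le_powr_tail[OF this e X[OF this]] show ?thesis
        using E Q by simp
    next
      \<comment> \<open>With an infinite tail the right-hand side is infinite unless
        \<open>E\<close> is a null set; there it is 0 times infinity, which is 0, but so is the
        left-hand side.\<close>
      case True
      have "emeasure lebesgue E \<le> ennreal (l ^ CARD('n))"
        using emeasure_mono[OF E(2), of lebesgue] Q l by (simp add: emeasure_cube)
      then have em: "emeasure lebesgue E = ennreal (measure lebesgue E)"
        by (intro emeasure_eq_ennreal_measure) (auto simp: top_unique)
      show ?thesis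
      proof (cases "measure lebesgue E = 0")
        case True
        then have "E \<in> null_sets lebesgue" using em E by (simp add: null_sets_def)
        then show ?thesis by (simp add: wmeasure_def nn_integral_null_set)
      next
        case False
        moreover have "measure lebesgue Q \<noteq> 0"
          using l Q by (simp add: measure_def emeasure_cube)
        ultimately have "0 < 5 * (measure lebesgue E / measure lebesgue Q) powr (e / (1 + e))"
          by simp
        then show ?thesis
          using True by (simp add: ennreal_mult_top)
      qed
    qed
  qed
  then show ?thesis
    using w e unfolding Cp_class_def
    by (intro CollectI conjI exI[of _ 5] exI[of _ "e / (1 + e)"]) auto
qed

end

theorem theorem1p1:
  fixes p :: real
  assumes "1 < p"
  shows "\<exists>B :: real. 0 < B \<and>
    (\<forall>w :: real ^ 'n \<Rightarrow> real.
       weight w \<and> 0 < Cp_const p w \<and> Cp_const p w < \<infinity> \<longrightarrow>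
         w \<in> Cp_class p \<and>
         (let \<delta> = 1 / (B * max (enn2real (Cp_const p w)) 1) in
            \<forall>Q\<in>cubes.
              epowr ((\<integral>\<^sup>+x\<in>Q. ennreal (w x powr (1 + \<delta>)) \<partial>lebesgue) / emeasure lebesgue Q)
                    (1 / (1 + \<delta>))
                \<le> 4 / emeasure lebesgue Q * Cp_tail p w Q))"
proof -
  define K where "K = mass_const TYPE('n) p"
  define C where "C = 2 * (3 ^ CARD('n)) powr p"
  \<comment> \<open>The two summands serve the two smallness conditions on \<delta>: the first
    permits absorption in the stopping argument, the second gives
    \<open>C powr \<delta> \<le> 2\<close>.\<close>
  define B where "B = 2 * 2 ^ CARD('n) * K + log 2 C"
  have K: "0 < K"
    using near_const_nonneg[OF assms, where 'n='n]
    by (auto simp: K_def mass_const_def intro!: add_nonneg_pos)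
  have "1 \<le> (3 ^ CARD('n)) powr p" using assms by (intro ge_one_powr_ge_zero) auto
  then have C: "1 \<le> C" by (simp add: C_def)
  then have logC: "0 \<le> log 2 C" by simp
  have "0 < 2 * 2 ^ CARD('n) * K" using K by simp
  then have B: "0 < B" using logC unfolding B_def by linarith
  show ?thesis
  proof (intro exI[of _ B] conjI allI impI B)
    fix w :: "real ^ 'n \<Rightarrow> real"
    assume wC: "weight w \<and> 0 < Cp_const p w \<and> Cp_const p w < \<infinity>"
    interpret Cp_weight p w using assms wC by unfold_locales auto
    define m where "m = max (enn2real (Cp_const p w)) 1"
    define \<delta> where "\<delta> = 1 / (B * m)"
    have m: "1 \<le> m" by (simp add: m_def)
    have \<delta>: "0 < \<delta>" using B m by (simp add: \<delta>_def)
    have "2 * 2 ^ CARD('n) * K \<le> B" using logC by (simp add: B_def)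
    then have e1: "2 * (2 ^ CARD('n) * (K * m) * \<delta>) \<le> 1"
      using B m by (simp add: \<delta>_def field_simps)
    have "log 2 C \<le> B * m"
    proof -
      have "log 2 C \<le> B * 1" using K by (simp add: B_def)
      also have "\<dots> \<le> B * m" using B m by (intro mult_left_mono) auto
      finally show ?thesis .
    qed
    then have "log 2 C * \<delta> \<le> 1" using B m by (simp add: \<delta>_def)
    then have "2 powr (log 2 C * \<delta>) \<le> 2 powr 1" by (intro powr_mono) auto
    then have e2: "C powr \<delta> \<le> 2" using C by (simp add: powr_powr[symmetric])
    have RH: "(\<integral>\<^sup>+x\<in>closed_cube R. ennreal (w x powr (1 + \<delta>)) \<partial>lebesgue)
      \<le> ennreal (4 * (tail_avg R powr (1 + \<delta>) * snd R ^ CARD('n)))" if "node R" for R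
    proof (rule reverse_Holder_half_cube[OF _ that \<delta>])
      show "Cp_const p w < \<infinity>" using wC by blast
    qed (use e1 e2 in \<open>simp_all add: K_def C_def m_def\<close>)
    show "w \<in> Cp_class p" by (rule Cp_classI[OF \<delta> RH])
    have "epowr ((\<integral>\<^sup>+x\<in>Q. ennreal (w x powr (1 + \<delta>)) \<partial>lebesgue) / emeasure lebesgue Q) (1 / (1 + \<delta>))
        \<le> 4 / emeasure lebesgue Q * Cp_tail p w Q" if "Q \<in> cubes" for Q
    proof -
      obtain a l where l: "0 < l" and Q: "Q = cube a l" using \<open>Q \<in> cubes\<close> by (rule cubesE)
      show ?thesis
      proof (cases "Cp_tail p w Q = \<infinity>")
        case False
        then have "node (a, l)" using l Q by (simp add: node_def less_top)
        from epowr_reverse_Holder[OF this \<delta> RH[OF this]] show ?thesis using Q by simp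
      next
        case True
        have "4 / emeasure lebesgue Q \<noteq> 0"
          using l Q by (simp add: emeasure_cube ennreal_divide_eq_0_iff)
        with True show ?thesis by (simp add: ennreal_mult_top)
      qed
    qed
    then show "let \<delta> = 1 / (B * max (enn2real (Cp_const p w)) 1) in \<forall>Q\<in>cubes.
        epowr ((\<integral>\<^sup>+x\<in>Q. ennreal (w x powr (1 + \<delta>)) \<partial>lebesgue) / emeasure lebesgue Q) (1 / (1 + \<delta>))
          \<le> 4 / emeasure lebesgue Q * Cp_tail p w Q"
      unfolding Let_def m_def[symmetric] \<delta>_def[symmetric] by blast
  qed
qed

end
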